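(* Let $p$ be a natural number. If $\Omega\subset\mathbb{C}$ is a smooth bounded one-point quadrature domain with respect to the boundary measure $|z|^{-2p}dz$, and if the origin is outside the closure of $\Omega$, then $\Omega$ is a $p$th root of a disc.
   Context: Natural numbers are $1,2,3,\dots$; a smooth bounded domain is a bounded connected open set with $\mathcal{C}^\infty$ smooth boundary, and $\partial\Omega$ is positively oriented. $\mathcal{A}^\infty(\Omega)$ is the space of analytic functions on $\Omega$ that are $\mathcal{C}^\infty$ smooth up to the boundary. $\Omega$ is a one-point quadrature domain with respect to the boundary measure $|z|^{-2p}dz$ if there are a constant $c\in\mathbb{C}$ and a point $z_0\in\Omega$ (the quadrature node) such that $\int_{\partial\Omega}f(z)|z|^{-2p}dz=c\,f(z_0)$ for all $f\in\mathcal{A}^\infty(\Omega)$. A $p$th root of a disc is a set of the form $\{\sqrt[p]{z}:|z-a|<r\}$ with $a\in\mathbb{C}$ and $0<r<|a|$, where $\sqrt[p]{z}$ denotes an analytic branch of $z^{1/p}$ on the disc $|z-a|<r$. *)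

theory Defs
  imports "HOL-Complex_Analysis.Complex_Analysis"
begin

text \<open>A smooth Jordan curve is given by a regular 1-periodic parametrization of class
  \<open>C\<^sup>\<infinity>\<close>; periodicity makes all derivatives agree at the end points of \<open>{0..1}\<close>.\<close>

definition smooth_jordan_curve :: "(real \<Rightarrow> complex) \<Rightarrow> bool" where
  "smooth_jordan_curve \<gamma> \<longleftrightarrow>
     (\<exists>D :: nat \<Rightarrow> real \<Rightarrow> complex. D 0 = \<gamma> \<and>
        (\<forall>n t. (D n has_vector_derivative D (Suc n) t) (at t))) \<and>
     (\<forall>t. vector_derivative \<gamma> (at t) \<noteq> 0) \<and>
     (\<forall>t. \<gamma> (t + 1) = \<gamma> t) \<and>
     inj_on \<gamma> {0..<1}"

text \<open>Positive orientation: \<open>i\<gamma>'\<close> points into \<open>\<Omega>\<close>, so \<open>\<Omega>\<close> lies to the left of each boundary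
  curve.  No local one-sidedness has to be imposed: \<open>\<Omega>\<close> is going to be connected and disjoint
  from its frontier, so it lies in a single component of the complement of each curve.\<close>

definition positive_boundary_param :: "complex set \<Rightarrow> (real \<Rightarrow> complex) set \<Rightarrow> bool" where
  "positive_boundary_param \<Omega> \<Gamma> \<longleftrightarrow>
     finite \<Gamma> \<and>
     (\<forall>\<gamma>\<in>\<Gamma>. smooth_jordan_curve \<gamma>) \<and>
     pairwise (\<lambda>\<gamma> \<delta>. disjnt (path_image \<gamma>) (path_image \<delta>)) \<Gamma> \<and>
     frontier \<Omega> = (\<Union>\<gamma>\<in>\<Gamma>. path_image \<gamma>) \<and>
     (\<forall>\<gamma>\<in>\<Gamma>. \<forall>t. \<forall>\<^sub>F \<epsilon> in at_right 0.
        \<gamma> t + of_real \<epsilon> * (\<i> * vector_derivative \<gamma> (at t)) \<in> \<Omega>)"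

definition smooth_bounded_domain :: "complex set \<Rightarrow> bool" where
  "smooth_bounded_domain \<Omega> \<longleftrightarrow>
     open \<Omega> \<and> connected \<Omega> \<and> bounded \<Omega> \<and> (\<exists>\<Gamma>. positive_boundary_param \<Omega> \<Gamma>)"

text \<open>Two positive parametrizations of the boundary differ by orientation preserving changes of
  parameter, so the value does not depend on the one that is chosen.\<close>

definition boundary_integral :: "complex set \<Rightarrow> (complex \<Rightarrow> complex) \<Rightarrow> complex" where
  "boundary_integral \<Omega> f =
     (\<Sum>\<gamma>\<in>(SOME \<Gamma>. positive_boundary_param \<Omega> \<Gamma>). contour_integral \<gamma> f)"

text \<open>Smoothness up to the boundary means that all partial derivatives extend continuously to
  the closure; for an analytic function these are the \<open>i\<^sup>k f\<^sup>(\<^sup>n\<^sup>)\<close>.  The function carries its own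
  boundary values, hence the separate continuity of \<open>f\<close> on the closure.\<close>

definition A_infinity :: "complex set \<Rightarrow> (complex \<Rightarrow> complex) set" where
  "A_infinity \<Omega> =
     {f. f holomorphic_on \<Omega> \<and> continuous_on (closure \<Omega>) f \<and>
         (\<forall>n. \<exists>g. continuous_on (closure \<Omega>) g \<and> (\<forall>z\<in>\<Omega>. g z = (deriv ^^ n) f z))}"

text \<open>The weight \<open>|z|\<^sup>-\<^sup>2\<^sup>p\<close> makes sense only when the origin is not on the boundary.\<close>

definition one_point_quadrature_domain :: "nat \<Rightarrow> complex set \<Rightarrow> bool" where
  "one_point_quadrature_domain p \<Omega> \<longleftrightarrow>
     (\<exists>c. \<exists>z\<^sub>0\<in>\<Omega>. \<forall>f\<in>A_infinity \<Omega>.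
        boundary_integral \<Omega> (\<lambda>z. f z * of_real (cmod z powi (- (2 * int p)))) = c * f z\<^sub>0)"

definition pth_root_of_disc :: "nat \<Rightarrow> complex set \<Rightarrow> bool" where
  "pth_root_of_disc p \<Omega> \<longleftrightarrow>
     (\<exists>a r g. 0 < r \<and> r < cmod a \<and>
        g holomorphic_on ball a r \<and> (\<forall>z\<in>ball a r. g z ^ p = z) \<and>
        \<Omega> = g ` ball a r)"

end

theory Submission imports Defs begin

text \<open>Write \<open>w = 1 / z\<^sup>p\<close>, so that the weight \<open>|z|\<close> to the power \<open>-2p\<close> is \<open>w cnj w\<close>.  Testing the
  quadrature identity with \<open>u\<^sup>p / (u - z)\<close> for \<open>z\<close> outside the closure of \<open>\<Omega>\<close> gives the exterior
  Cauchy transform of \<open>cnj w\<close>, a simple fraction with pole at \<open>z\<^sub>0\<close>.  By the jump relation \<open>cnj w\<close> on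
  the boundary is then the boundary value of a function \<open>S\<close> that is holomorphic in \<open>\<Omega>\<close> except for a
  simple pole at \<open>z\<^sub>0\<close>.  Hence \<open>(S - cnj (w z\<^sub>0)) (w - w z\<^sub>0)\<close> is holomorphic and has the real boundary
  values \<open>|w - w z\<^sub>0|\<^sup>2\<close>, so it is constant: \<open>w\<close> maps the boundary into a circle about \<open>w z\<^sub>0\<close> and
  \<open>\<Omega>\<close> onto the disc inside it.  That closed disc misses \<open>0\<close>, so \<open>z\<^sup>p = 1 / w\<close> maps \<open>\<Omega>\<close> onto a disc as
  well, and \<open>\<Omega>\<close>, being connected, is the image of a single branch of the \<open>p\<close>-th root.\<close>

subsection \<open>Jump of the winding number across a smooth curve\<close>

text \<open>The quantity bounded from below is the product of
  \<open>\<beta> s - \<i> * \<epsilon> * T\<close> and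
  \<open>\<beta> s + \<i> * \<epsilon> * T\<close>. For small \<open>s\<close> it is
  \<open>T^2 * (s^2 + \<epsilon>^2)\<close> up to an error of order \<open>\<bar>s\<bar>^3\<close>;
  for the other \<open>s\<close>, compactness keeps \<open>\<beta>\<close> away from 0 and the term
  with \<open>\<epsilon>\<close> is small in comparison.\<close>

lemma regular_arc_denominator_bound:
  fixes \<beta> :: "real \<Rightarrow> complex" and T :: complex and M :: real
  assumes cont: "continuous_on {-1/2..1/2} \<beta>"
    and T: "T \<noteq> 0" and M: "M \<ge> 0"
    and e: "\<And>s. \<bar>s\<bar> \<le> 1/2 \<Longrightarrow> norm (\<beta> s - of_real s * T) \<le> M * s\<^sup>2"
    and nz: "\<And>s. \<bar>s\<bar> \<le> 1/2 \<Longrightarrow> s \<noteq> 0 \<Longrightarrow> \<beta> s \<noteq> 0"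
  obtains c \<epsilon>0 where "c > 0" "\<epsilon>0 > 0"
    "\<And>s \<epsilon>. \<bar>s\<bar> \<le> 1/2 \<Longrightarrow> 0 < \<epsilon> \<Longrightarrow> \<epsilon> \<le> \<epsilon>0 \<Longrightarrow>
       c * (s\<^sup>2 + \<epsilon>\<^sup>2) \<le> norm ((\<beta> s)\<^sup>2 + (of_real \<epsilon> * T)\<^sup>2)"
proof -
  define t where "t = norm T"
  have t: "t > 0" using T by (simp add: t_def)
  \<comment> \<open>\<open>\<delta>\<close> is chosen so that for
    \<open>\<bar>s\<bar> < \<delta>\<close> the error is at most half of the main term.\<close>
  have "((\<lambda>\<delta>. 2 * t * M * \<delta> + M\<^sup>2 * \<delta>\<^sup>2) \<longlongrightarrow> 2 * t * M * 0 + M\<^sup>2 * 0\<^sup>2) (at_right 0)"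
    by (intro tendsto_intros)
  then have "\<forall>\<^sub>F \<delta> in at_right 0. 2 * t * M * \<delta> + M\<^sup>2 * \<delta>\<^sup>2 < t\<^sup>2 / 2"
    using t by (intro order_tendstoD(2)[where y = "2 * t * M * 0 + M\<^sup>2 * 0\<^sup>2"]) auto
  moreover have "\<forall>\<^sub>F \<delta>::real in at_right 0. \<delta> > 0" by (rule eventually_at_right_less)
  ultimately have "\<forall>\<^sub>F \<delta> in at_right 0. \<delta> > 0 \<and> 2 * t * M * \<delta> + M\<^sup>2 * \<delta>\<^sup>2 < t\<^sup>2 / 2"
    by eventually_elim auto
  then obtain \<delta> where \<delta>: "\<delta> > 0" "2 * t * M * \<delta> + M\<^sup>2 * \<delta>\<^sup>2 < t\<^sup>2 / 2"
    using eventually_happens'[OF trivial_limit_at_right_real] by blast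
  define A where "A = {-1/2..1/2} - {-\<delta><..<\<delta>}"
  have "\<exists>m>0. \<forall>s\<in>A. norm (\<beta> s) \<ge> m"
  proof (cases "A = {}")
    case False
    have "compact A" unfolding A_def by (intro compact_diff) auto
    moreover have "continuous_on A (\<lambda>s. norm (\<beta> s))"
      by (intro continuous_on_norm continuous_on_subset[OF cont]) (auto simp: A_def)
    ultimately obtain s0 where s0: "s0 \<in> A" "\<forall>s\<in>A. norm (\<beta> s0) \<le> norm (\<beta> s)"
      using False continuous_attains_inf by blast
    have "norm (\<beta> s0) > 0" using nz[of s0] s0(1) \<delta> by (auto simp: A_def abs_le_iff)
    then show ?thesis using s0 by blast
  qed (auto intro: exI[of _ 1])
  then obtain m where m: "m > 0" "\<And>s. s \<in> A \<Longrightarrow> norm (\<beta> s) \<ge> m" by blast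
  \<comment> \<open>\<open>t^2 / 2\<close> is what the error leaves of the main term for small
    \<open>s\<close>. For the other \<open>s\<close> the norm is at least
    \<open>m^2 - m^2 / 4\<close>, while \<open>s^2 + \<epsilon>^2\<close> is at most 2, whence
    \<open>3 * m^2 / 8\<close>; the bound \<open>\<epsilon>0\<close> gives both
    \<open>\<epsilon> * t \<le> m / 2\<close> and \<open>\<epsilon> \<le> 1\<close>.\<close>
  define c where "c = min (t\<^sup>2 / 2) (3 * m\<^sup>2 / 8)"
  define \<epsilon>0 where "\<epsilon>0 = min 1 (m / (2 * t))"
  show ?thesis
  proof (rule that)
    show "c > 0" "\<epsilon>0 > 0" using t m by (auto simp: c_def \<epsilon>0_def)
    fix s \<epsilon> :: real assume s: "\<bar>s\<bar> \<le> 1/2" and \<epsilon>: "0 < \<epsilon>" "\<epsilon> \<le> \<epsilon>0"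
    show "c * (s\<^sup>2 + \<epsilon>\<^sup>2) \<le> norm ((\<beta> s)\<^sup>2 + (of_real \<epsilon> * T)\<^sup>2)"
    proof (cases "\<bar>s\<bar> < \<delta>")
      case True
      define r where "r = \<beta> s - of_real s * T"
      have r: "norm r \<le> M * s\<^sup>2" using e[OF s] by (simp add: r_def)
      have eq: "(\<beta> s)\<^sup>2 + (of_real \<epsilon> * T)\<^sup>2 = T\<^sup>2 * of_real (s\<^sup>2 + \<epsilon>\<^sup>2) + (2 * of_real s * T * r + r\<^sup>2)"
        by (simp add: r_def power2_eq_square algebra_simps)
      have "norm (2 * of_real s * T * r + r\<^sup>2) \<le> norm (2 * of_real s * T * r) + norm (r\<^sup>2)"
        by (rule norm_triangle_ineq)
      also have "\<dots> = 2 * \<bar>s\<bar> * t * norm r + (norm r)\<^sup>2"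
        by (simp add: norm_mult norm_power t_def)
      also have "\<dots> \<le> 2 * \<bar>s\<bar> * t * (M * s\<^sup>2) + (M * s\<^sup>2)\<^sup>2"
        using r t M by (intro add_mono mult_left_mono power_mono) auto
      also have "\<dots> = (2 * t * M * \<bar>s\<bar> + M\<^sup>2 * \<bar>s\<bar>\<^sup>2) * s\<^sup>2"
        by (simp add: power2_eq_square algebra_simps)
      also have "\<dots> \<le> (2 * t * M * \<delta> + M\<^sup>2 * \<delta>\<^sup>2) * s\<^sup>2"
        using True t M by (intro add_mono mult_left_mono mult_right_mono power_mono) auto
      also have "\<dots> \<le> t\<^sup>2 / 2 * s\<^sup>2" using \<delta>(2) by (intro mult_right_mono) auto
      also have "\<dots> \<le> t\<^sup>2 / 2 * (s\<^sup>2 + \<epsilon>\<^sup>2)" by (intro mult_left_mono) auto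
      finally have 1: "norm (2 * of_real s * T * r + r\<^sup>2) \<le> t\<^sup>2 / 2 * (s\<^sup>2 + \<epsilon>\<^sup>2)" .
      have 2: "norm (T\<^sup>2 * of_real (s\<^sup>2 + \<epsilon>\<^sup>2)) = t\<^sup>2 * (s\<^sup>2 + \<epsilon>\<^sup>2)"
        unfolding norm_mult norm_power norm_of_real t_def by simp
      have "t\<^sup>2 * (s\<^sup>2 + \<epsilon>\<^sup>2) - t\<^sup>2 / 2 * (s\<^sup>2 + \<epsilon>\<^sup>2) \<le> norm ((\<beta> s)\<^sup>2 + (of_real \<epsilon> * T)\<^sup>2)"
        unfolding eq using 1 2 norm_diff_ineq[of "T\<^sup>2 * of_real (s\<^sup>2 + \<epsilon>\<^sup>2)" "2 * of_real s * T * r + r\<^sup>2"]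
        by linarith
      moreover have "c * (s\<^sup>2 + \<epsilon>\<^sup>2) \<le> t\<^sup>2 / 2 * (s\<^sup>2 + \<epsilon>\<^sup>2)"
        by (intro mult_right_mono) (auto simp: c_def)
      ultimately show ?thesis by (simp add: field_simps)
    next
      case False
      have "m \<le> norm (\<beta> s)" using False s by (intro m(2)) (auto simp: A_def abs_if split: if_splits)
      then have 1: "m\<^sup>2 \<le> norm ((\<beta> s)\<^sup>2)" using m(1) by (simp add: norm_power power_mono)
      have "\<epsilon> * t \<le> m / 2" using \<epsilon>(2) t by (simp add: \<epsilon>0_def field_simps)
      then have "(\<epsilon> * t)\<^sup>2 \<le> (m / 2)\<^sup>2" using \<epsilon> t by (intro power_mono) auto
      then have 2: "norm ((of_real \<epsilon> * T)\<^sup>2) \<le> m\<^sup>2 / 4"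
        using \<epsilon> by (simp add: norm_power norm_mult t_def power_divide)
      have "s\<^sup>2 \<le> 1" "\<epsilon>\<^sup>2 \<le> 1" using s \<epsilon>
        by (auto simp: abs_square_le_1 \<epsilon>0_def)
      then have "c * (s\<^sup>2 + \<epsilon>\<^sup>2) \<le> 3 * m\<^sup>2 / 8 * 2"
        by (intro mult_mono) (auto simp: c_def)
      then show ?thesis using 1 2 norm_diff_ineq[of "(\<beta> s)\<^sup>2" "(of_real \<epsilon> * T)\<^sup>2"] by simp
    qed
  qed
qed

text \<open>\<open>arctan (s / \<epsilon>)\<close> is an antiderivative of the real kernel. As
  \<open>\<epsilon>\<close> tends to 0 the value tends to \<open>4 * \<i> * pi / 2\<close>, so the
  tangent line alone accounts for the whole jump.\<close>

lemma integral_Cauchy_kernel: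
  fixes \<epsilon> :: real
  assumes "\<epsilon> > 0"
  shows "((\<lambda>s. 2 * \<i> * of_real (\<epsilon> / (s\<^sup>2 + \<epsilon>\<^sup>2))) has_integral
           4 * \<i> * of_real (arctan (1 / (2 * \<epsilon>)))) {-1/2..1/2}"
proof -
  have "((\<lambda>s. \<epsilon> / (s\<^sup>2 + \<epsilon>\<^sup>2)) has_integral arctan (1/2 / \<epsilon>) - arctan (-1/2 / \<epsilon>)) {-1/2..1/2}"
  proof (rule fundamental_theorem_of_calculus)
    fix x :: real
    have "inverse (1 + (x / \<epsilon>)\<^sup>2) * (1 / \<epsilon>) = \<epsilon> / (x\<^sup>2 + \<epsilon>\<^sup>2)"
      using assms by (simp add: field_simps power2_eq_square add_pos_nonneg)
    moreover have "((\<lambda>x. arctan (x / \<epsilon>)) has_real_derivative inverse (1 + (x / \<epsilon>)\<^sup>2) * (1 / \<epsilon>)) (at x)"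
      by (intro derivative_eq_intros) (use assms in auto)
    ultimately show "((\<lambda>x. arctan (x / \<epsilon>)) has_vector_derivative \<epsilon> / (x\<^sup>2 + \<epsilon>\<^sup>2)) (at x within {-1/2..1/2})"
      by (metis has_real_derivative_iff_has_vector_derivative has_vector_derivative_at_within)
  qed simp
  then have "((\<lambda>s. 2 * \<i> * of_real (\<epsilon> / (s\<^sup>2 + \<epsilon>\<^sup>2))) has_integral
       2 * \<i> * of_real (arctan (1/2 / \<epsilon>) - arctan (-1/2 / \<epsilon>))) {-1/2..1/2}"
    by (intro has_integral_mult_right has_integral_of_real)
  then show ?thesis by (simp add: arctan_minus mult.assoc)
qed

text \<open>The integrand is \<open>\<beta>' / (\<beta> - \<i>\<epsilon>T) - \<beta>' / (\<beta> + \<i>\<epsilon>T)\<close>.  Its difference from the same kernel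
  \<open>2\<i>\<epsilon> / (s\<^sup>2 + \<epsilon>\<^sup>2)\<close> of the tangent line stays bounded and tends to \<open>0\<close> pointwise.\<close>

lemma Cauchy_kernel_jump:
  fixes \<beta> \<beta>' :: "real \<Rightarrow> complex" and T :: complex and M :: real
  assumes cont: "continuous_on {-1/2..1/2} \<beta>" and cont': "continuous_on {-1/2..1/2} \<beta>'"
    and T: "T \<noteq> 0" and M: "M \<ge> 0"
    and e: "\<And>s. \<bar>s\<bar> \<le> 1/2 \<Longrightarrow> norm (\<beta> s - of_real s * T) \<le> M * s\<^sup>2"
    and e': "\<And>s. \<bar>s\<bar> \<le> 1/2 \<Longrightarrow> norm (\<beta>' s - T) \<le> M * \<bar>s\<bar>"
    and nz: "\<And>s. \<bar>s\<bar> \<le> 1/2 \<Longrightarrow> s \<noteq> 0 \<Longrightarrow> \<beta> s \<noteq> 0"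
  shows "((\<lambda>\<epsilon>. integral {-1/2..1/2} (\<lambda>s. 2 * \<i> * of_real \<epsilon> * T * \<beta>' s / ((\<beta> s)\<^sup>2 + (of_real \<epsilon> * T)\<^sup>2)))
           \<longlongrightarrow> 2 * of_real pi * \<i>) (at_right 0)"
    and "\<forall>\<^sub>F \<epsilon> in at_right 0. \<forall>s. \<bar>s\<bar> \<le> 1/2 \<longrightarrow> (\<beta> s)\<^sup>2 + (of_real \<epsilon> * T)\<^sup>2 \<noteq> 0"
proof -
  obtain c \<epsilon>0 where c: "c > 0" "\<epsilon>0 > 0"
    "\<And>s \<epsilon>. \<bar>s\<bar> \<le> 1/2 \<Longrightarrow> 0 < \<epsilon> \<Longrightarrow> \<epsilon> \<le> \<epsilon>0 \<Longrightarrow>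
       c * (s\<^sup>2 + \<epsilon>\<^sup>2) \<le> norm ((\<beta> s)\<^sup>2 + (of_real \<epsilon> * T)\<^sup>2)"
    using regular_arc_denominator_bound[OF cont T M e nz] by blast
  define E where "E = (\<lambda>\<epsilon> s. (\<beta> s)\<^sup>2 + (of_real \<epsilon> * T)\<^sup>2)"
  define I where "I = (\<lambda>\<epsilon> s. 2 * \<i> * of_real \<epsilon> * T * \<beta>' s / E \<epsilon> s)"
  define J where "J = (\<lambda>\<epsilon> s. 2 * \<i> * complex_of_real (\<epsilon> / (s\<^sup>2 + \<epsilon>\<^sup>2)))"
  \<comment> \<open>In the bound of the numerator \<open>N\<close> below, one
    \<open>norm T * M\<close> comes from \<open>r'\<close>, two come from the cross term
    \<open>2 * s * T * r\<close>, and \<open>M^2\<close> comes from \<open>r^2\<close>.\<close>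
  define M1 where "M1 = 3 * norm T * M + M\<^sup>2"
  have M1: "M1 \<ge> 0" using M by (simp add: M1_def)
  have Enz: "E \<epsilon> s \<noteq> 0" if "\<bar>s\<bar> \<le> 1/2" "0 < \<epsilon>" "\<epsilon> \<le> \<epsilon>0" for s \<epsilon>
  proof -
    have "c * (s\<^sup>2 + \<epsilon>\<^sup>2) > 0" using c(1) that by (simp add: add_nonneg_pos)
    then show ?thesis using c(3)[OF that] by (auto simp: E_def)
  qed
  have ev: "\<forall>\<^sub>F \<epsilon> in at_right 0. 0 < \<epsilon> \<and> \<epsilon> \<le> \<epsilon>0"
    unfolding eventually_at_right_field using c(2) by (intro exI[of _ \<epsilon>0]) auto
  then show "\<forall>\<^sub>F \<epsilon> in at_right 0. \<forall>s. \<bar>s\<bar> \<le> 1/2 \<longrightarrow> (\<beta> s)\<^sup>2 + (of_real \<epsilon> * T)\<^sup>2 \<noteq> 0"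
    by eventually_elim (use Enz in \<open>auto simp: E_def\<close>)
  \<comment> \<open>This bound is used twice: since
    \<open>2 * \<epsilon> * \<bar>s\<bar> \<le> s^2 + \<epsilon>^2\<close> it yields the dominating
    constant \<open>M1 / c\<close>, and for fixed \<open>s\<close> it tends to 0 with
    \<open>\<epsilon>\<close>.\<close>
  have diff: "norm (I \<epsilon> s - J \<epsilon> s) \<le> (2 * \<epsilon> * \<bar>s\<bar> / (s\<^sup>2 + \<epsilon>\<^sup>2)) * (M1 / c)"
    if s: "\<bar>s\<bar> \<le> 1/2" and \<epsilon>: "0 < \<epsilon>" "\<epsilon> \<le> \<epsilon>0" for s \<epsilon>
  proof -
    define q where "q = s\<^sup>2 + \<epsilon>\<^sup>2"
    have q: "q > 0" using \<epsilon> by (simp add: q_def add_nonneg_pos)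
    define r where "r = \<beta> s - of_real s * T"
    define r' where "r' = \<beta>' s - T"
    \<comment> \<open>Over the common denominator \<open>E \<epsilon> s * q\<close> the leading
      terms \<open>T^2 * q\<close> of the two kernels cancel. What remains is of order
      \<open>\<bar>s\<bar> * q\<close>, because \<open>r'\<close> is of order
      \<open>\<bar>s\<bar>\<close> and \<open>r\<close> of order \<open>s^2\<close>.\<close>
    define N where "N = T * r' * of_real q - (2 * of_real s * T * r + r\<^sup>2)"
    have r: "norm r \<le> M * s\<^sup>2" and r': "norm r' \<le> M * \<bar>s\<bar>"
      using e[OF s] e'[OF s] by (simp_all add: r_def r'_def)
    have sq: "s\<^sup>2 \<le> q" by (simp add: q_def)
    have "T * \<beta>' s * of_real q - E \<epsilon> s = N"
      by (simp add: N_def E_def r_def r'_def q_def power2_eq_square algebra_simps)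
    moreover have "I \<epsilon> s - J \<epsilon> s =
        2 * \<i> * of_real \<epsilon> * (T * \<beta>' s * of_real q - E \<epsilon> s) / (E \<epsilon> s * of_real q)"
      using Enz[OF s \<epsilon>] q unfolding I_def J_def q_def[symmetric]
      by (simp add: divide_simps) (simp add: algebra_simps)
    ultimately have "I \<epsilon> s - J \<epsilon> s = 2 * \<i> * of_real \<epsilon> * N / (E \<epsilon> s * of_real q)" by simp
    then have 1: "norm (I \<epsilon> s - J \<epsilon> s) = 2 * \<epsilon> * norm N / (norm (E \<epsilon> s) * q)"
      using \<epsilon> q by (simp add: norm_mult norm_divide)
    have "norm N \<le> norm (T * r' * of_real q) + (norm (2 * of_real s * T * r) + norm (r\<^sup>2))"
      unfolding N_def
      using norm_triangle_ineq4[of "T * r' * of_real q" "2 * of_real s * T * r + r\<^sup>2"]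
        norm_triangle_ineq[of "2 * of_real s * T * r" "r\<^sup>2"] by linarith
    also have "\<dots> = norm T * norm r' * q + (2 * \<bar>s\<bar> * norm T * norm r + (norm r)\<^sup>2)"
      using q by (simp add: norm_mult norm_power)
    also have "\<dots> \<le> norm T * (M * \<bar>s\<bar>) * q + (2 * \<bar>s\<bar> * norm T * (M * s\<^sup>2) + (M * s\<^sup>2)\<^sup>2)"
      using r r' q M by (intro add_mono mult_mono power_mono) auto
    also have "(M * s\<^sup>2)\<^sup>2 = M\<^sup>2 * (\<bar>s\<bar> * \<bar>s\<bar>) * s\<^sup>2"
      by (simp add: power2_eq_square)
    also have "\<dots> \<le> M\<^sup>2 * (\<bar>s\<bar> * 1) * q"
      using s M sq by (intro mult_mono) auto
    also have "2 * \<bar>s\<bar> * norm T * (M * s\<^sup>2) \<le> 2 * \<bar>s\<bar> * norm T * (M * q)"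
      using sq M by (intro mult_left_mono) auto
    finally have N: "norm N \<le> M1 * \<bar>s\<bar> * q"
      by (simp add: M1_def algebra_simps)
    have "2 * \<epsilon> * norm N / (norm (E \<epsilon> s) * q) \<le> 2 * \<epsilon> * (M1 * \<bar>s\<bar> * q) / (c * q * q)"
      using N c(1) c(3)[OF s \<epsilon>] q \<epsilon> M1
      by (intro frac_le mult_left_mono mult_right_mono mult_pos_pos) (auto simp: E_def q_def)
    also have "\<dots> = (2 * \<epsilon> * \<bar>s\<bar> / q) * (M1 / c)" using q by (simp add: mult_ac)
    finally show ?thesis using 1 by (simp add: q_def)
  qed
  have bound: "norm (I \<epsilon> s - J \<epsilon> s) \<le> M1 / c"
    if s: "\<bar>s\<bar> \<le> 1/2" and \<epsilon>: "0 < \<epsilon>" "\<epsilon> \<le> \<epsilon>0" for s \<epsilon>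
  proof -
    have "0 \<le> (\<bar>s\<bar> - \<epsilon>)\<^sup>2" by simp
    then have "2 * \<epsilon> * \<bar>s\<bar> \<le> s\<^sup>2 + \<epsilon>\<^sup>2" by (simp add: power2_diff mult_ac)
    then have "2 * \<epsilon> * \<bar>s\<bar> / (s\<^sup>2 + \<epsilon>\<^sup>2) \<le> 1"
      using \<epsilon> by (simp add: divide_le_eq_1 add_nonneg_pos)
    then have "(2 * \<epsilon> * \<bar>s\<bar> / (s\<^sup>2 + \<epsilon>\<^sup>2)) * (M1 / c) \<le> 1 * (M1 / c)"
      using M1 c by (intro mult_right_mono) auto
    then show ?thesis using diff[OF that] by linarith
  qed
  have intJ: "(J \<epsilon> has_integral 4 * \<i> * of_real (arctan (1 / (2 * \<epsilon>)))) {-1/2..1/2}" if "\<epsilon> > 0" for \<epsilon>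
    unfolding J_def using integral_Cauchy_kernel[OF that] .
  have intI: "I \<epsilon> integrable_on {-1/2..1/2}" if "0 < \<epsilon>" "\<epsilon> \<le> \<epsilon>0" for \<epsilon>
    unfolding I_def
    by (intro integrable_continuous_interval continuous_intros cont' continuous_on_divide)
       (use Enz[OF _ that] cont in \<open>auto simp: E_def abs_le_iff intro!: continuous_intros\<close>)
  \<comment> \<open>Near 0 the set \<open>{0<..\<epsilon>0}\<close> gives the same filter as
    \<open>at_right 0\<close>, but every term of a sequence in it satisfies
    \<open>\<epsilon> \<le> \<epsilon>0\<close>, so the domination holds from the first index
    on.\<close>
  have "((\<lambda>\<epsilon>. integral {-1/2..1/2} (\<lambda>s. I \<epsilon> s - J \<epsilon> s)) \<longlongrightarrow> integral {-1/2..1/2::real} (\<lambda>s. 0))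
          (at 0 within {0<..\<epsilon>0})"
    unfolding tendsto_at_iff_sequentially comp_def
  proof (intro allI impI)
    fix X :: "nat \<Rightarrow> real" assume X: "\<forall>i. X i \<in> {0<..\<epsilon>0} - {0}" "X \<longlonglongrightarrow> 0"
    then have X1: "0 < X i" "X i \<le> \<epsilon>0" for i by auto
    show "(\<lambda>k. integral {-1/2..1/2} (\<lambda>s. I (X k) s - J (X k) s)) \<longlonglongrightarrow> integral {-1/2..1/2::real} (\<lambda>s. 0)"
    proof (rule dominated_convergence(2)[where h = "\<lambda>_. M1 / c"])
      show "(\<lambda>s. I (X k) s - J (X k) s) integrable_on {-1/2..1/2}" for k
        using intI[OF X1] intJ[OF X1(1)] by (intro integrable_diff) auto
      show "norm (I (X k) s - J (X k) s) \<le> M1 / c" if "s \<in> {-1/2..1/2}" for k s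
        using that by (intro bound X1) auto
      show "(\<lambda>k. I (X k) s - J (X k) s) \<longlonglongrightarrow> 0" if "s \<in> {-1/2..1/2}" for s
      proof (rule Lim_null_comparison)
        have s: "\<bar>s\<bar> \<le> 1/2" using that by auto
        show "\<forall>\<^sub>F k in sequentially. norm (I (X k) s - J (X k) s) \<le>
                (2 * X k * \<bar>s\<bar> / (s\<^sup>2 + (X k)\<^sup>2)) * (M1 / c)"
          using diff[OF s X1] by simp
        show "(\<lambda>k. (2 * X k * \<bar>s\<bar> / (s\<^sup>2 + (X k)\<^sup>2)) * (M1 / c)) \<longlonglongrightarrow> 0"
        proof (cases "s = 0")
          case False
          have "(\<lambda>k. (2 * X k * \<bar>s\<bar> / (s\<^sup>2 + (X k)\<^sup>2)) * (M1 / c)) \<longlonglongrightarrow>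
                  (2 * 0 * \<bar>s\<bar> / (s\<^sup>2 + 0\<^sup>2)) * (M1 / c)"
            using False by (intro tendsto_intros X) auto
          then show ?thesis by simp
        qed simp
      qed
    qed auto
  qed
  moreover have "at (0::real) within {0<..\<epsilon>0} = at_right 0"
    by (rule at_within_nhd[where S = "{-1<..<\<epsilon>0}"]) (use c in auto)
  ultimately have "((\<lambda>\<epsilon>. integral {-1/2..1/2} (\<lambda>s. I \<epsilon> s - J \<epsilon> s)) \<longlongrightarrow> 0) (at_right 0)"
    by simp
  moreover have "((\<lambda>\<epsilon>. 4 * \<i> * complex_of_real (arctan (1 / (2 * \<epsilon>)))) \<longlongrightarrow> 4 * \<i> * of_real (pi / 2)) (at_right 0)"
  proof (intro tendsto_intros filterlim_compose[OF tendsto_arctan_at_top])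
    have "filterlim (\<lambda>\<epsilon>::real. (1/2) * inverse \<epsilon>) at_top (at_right 0)"
      by (intro filterlim_tendsto_pos_mult_at_top[OF tendsto_const] filterlim_inverse_at_top_right) auto
    then show "filterlim (\<lambda>\<epsilon>::real. 1 / (2 * \<epsilon>)) at_top (at_right 0)"
      by (simp add: field_simps)
  qed
  ultimately have "((\<lambda>\<epsilon>. integral {-1/2..1/2} (\<lambda>s. I \<epsilon> s - J \<epsilon> s) + 4 * \<i> * complex_of_real (arctan (1 / (2 * \<epsilon>))))
       \<longlongrightarrow> 0 + 4 * \<i> * of_real (pi / 2)) (at_right 0)"
    by (rule tendsto_add)
  then have "((\<lambda>\<epsilon>. integral {-1/2..1/2} (I \<epsilon>)) \<longlongrightarrow> 0 + 4 * \<i> * of_real (pi / 2)) (at_right 0)"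
  proof (rule Lim_transform_eventually)
    show "\<forall>\<^sub>F \<epsilon> in at_right 0. integral {-1/2..1/2} (\<lambda>s. I \<epsilon> s - J \<epsilon> s) + 4 * \<i> * complex_of_real (arctan (1 / (2 * \<epsilon>)))
            = integral {-1/2..1/2} (I \<epsilon>)"
      using ev
    proof eventually_elim
      case (elim \<epsilon>)
      then have "integral {-1/2..1/2} (\<lambda>s. I \<epsilon> s - J \<epsilon> s) =
          integral {-1/2..1/2} (I \<epsilon>) - integral {-1/2..1/2} (J \<epsilon>)"
        by (intro integral_diff intI has_integral_integrable[OF intJ]) auto
      then show ?case using integral_unique[OF intJ[of \<epsilon>]] elim by simp
    qed
  qed
  then show "((\<lambda>\<epsilon>. integral {-1/2..1/2} (\<lambda>s. 2 * \<i> * of_real \<epsilon> * T * \<beta>' s / ((\<beta> s)\<^sup>2 + (of_real \<epsilon> * T)\<^sup>2)))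
           \<longlongrightarrow> 2 * of_real pi * \<i>) (at_right 0)"
    by (simp add: I_def E_def mult_ac)
qed

section \<open>Periodic parametrizations and the jump across a single curve\<close>

lemma smooth_jordan_curve_periodic:
  assumes "smooth_jordan_curve \<gamma>"
  shows "\<gamma> (t + of_int n) = \<gamma> t"
proof -
  interpret periodic_fun_simple' \<gamma>
    using assms by unfold_locales (simp add: smooth_jordan_curve_def)
  show ?thesis by (rule plus_of_int)
qed

lemma smooth_jordan_curve_eq_iff:
  assumes "smooth_jordan_curve \<gamma>"
  shows "\<gamma> s = \<gamma> t \<longleftrightarrow> s - t \<in> \<int>"
proof
  have fr: "\<gamma> (frac x) = \<gamma> x" for x
    using smooth_jordan_curve_periodic[OF assms, of "frac x" "\<lfloor>x\<rfloor>"] by (simp add: frac_def)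
  assume "\<gamma> s = \<gamma> t"
  then have "\<gamma> (frac s) = \<gamma> (frac t)" by (simp add: fr)
  moreover have "inj_on \<gamma> {0..<1}" using assms by (simp add: smooth_jordan_curve_def)
  ultimately have "frac s = frac t"
    by (auto dest!: inj_onD simp: frac_lt_1)
  then have "s - t = of_int (\<lfloor>s\<rfloor> - \<lfloor>t\<rfloor>)" by (simp add: frac_def)
  then show "s - t \<in> \<int>" by (metis Ints_of_int)
next
  assume "s - t \<in> \<int>"
  then obtain n where "s - t = of_int n" by (auto elim: Ints_cases)
  then have "s = t + of_int n" by simp
  then show "\<gamma> s = \<gamma> t" using smooth_jordan_curve_periodic[OF assms] by simp
qed

text \<open>The continuous second derivative is what later gives the quadratic bound on the distance
  between the curve and its tangent line.\<close>

lemma smooth_jordan_curve_vector_derivative: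
  assumes "smooth_jordan_curve \<gamma>"
  obtains D2 where
    "\<And>t. (\<gamma> has_vector_derivative vector_derivative \<gamma> (at t)) (at t)"
    "\<And>t. ((\<lambda>t. vector_derivative \<gamma> (at t)) has_vector_derivative D2 t) (at t)"
    "continuous_on UNIV (\<lambda>t. vector_derivative \<gamma> (at t))" "continuous_on UNIV D2"
proof -
  obtain D :: "nat \<Rightarrow> real \<Rightarrow> complex" where D: "D 0 = \<gamma>"
    "\<And>n t. (D n has_vector_derivative D (Suc n) t) (at t)"
    using assms by (auto simp: smooth_jordan_curve_def)
  have D1: "(\<lambda>t. vector_derivative \<gamma> (at t)) = D 1"
    using D(2)[of 0] D(1) by (auto simp: vector_derivative_at fun_eq_iff)
  have cont: "continuous_on UNIV (D n)" for n
    by (meson D(2) continuous_at_imp_continuous_on has_vector_derivative_continuous)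
  show ?thesis
  proof (rule that[of "D 2"])
    show "(\<gamma> has_vector_derivative vector_derivative \<gamma> (at t)) (at t)" for t
      using D(2)[of 0 t] D(1) vector_derivative_at by metis
    show "((\<lambda>t. vector_derivative \<gamma> (at t)) has_vector_derivative D 2 t) (at t)" for t
      unfolding D1 using D(2)[of 1] by (simp add: numeral_2_eq_2)
    show "continuous_on UNIV (\<lambda>t. vector_derivative \<gamma> (at t))"
      unfolding D1 by (rule cont)
  qed (rule cont)
qed

lemma smooth_jordan_curve_path:
  assumes "smooth_jordan_curve \<gamma>"
  shows "valid_path \<gamma>" "path \<gamma>" "pathfinish \<gamma> = pathstart \<gamma>" "path_image \<gamma> = range \<gamma>"
    "continuous_on UNIV (\<lambda>t. vector_derivative \<gamma> (at t))" "continuous_on UNIV \<gamma>"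
proof -
  obtain D2 where D2: "\<And>t. (\<gamma> has_vector_derivative vector_derivative \<gamma> (at t)) (at t)"
    "continuous_on UNIV (\<lambda>t. vector_derivative \<gamma> (at t))"
    using smooth_jordan_curve_vector_derivative[OF assms] by metis
  then have "\<gamma> C1_differentiable_on {0..1}"
    unfolding C1_differentiable_on_def by (meson continuous_on_subset top_greatest)
  then show v: "valid_path \<gamma>"
    by (simp add: C1_differentiable_imp_piecewise valid_path_def)
  then show "path \<gamma>" by (rule valid_path_imp_path)
  show "pathfinish \<gamma> = pathstart \<gamma>"
    using smooth_jordan_curve_periodic[OF assms, of 0 1] by (simp add: pathfinish_def pathstart_def)
  show "path_image \<gamma> = range \<gamma>"
  proof (auto simp: path_image_def)
    fix x
    have "\<gamma> x = \<gamma> (frac x)"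
      by (subst smooth_jordan_curve_eq_iff[OF assms]) (simp add: frac_def)
    then show "\<gamma> x \<in> \<gamma> ` {0..1}" by (metis atLeastAtMost_iff frac_ge_0 frac_lt_1 image_eqI less_imp_le)
  qed
  show "continuous_on UNIV (\<lambda>t. vector_derivative \<gamma> (at t))" by fact
  show "continuous_on UNIV \<gamma>"
    by (meson D2(1) continuous_at_imp_continuous_on has_vector_derivative_continuous)
qed

text \<open>Allows the integral over a closed curve to be recentred at any parameter
  \<open>t0\<close> of \<open>{0..1}\<close>, so that \<open>t0\<close> is interior to the interval
  even when it is 0 or 1. The part of the interval that sticks out of \<open>{0..1}\<close> is moved
  back by one period.\<close>

lemma integral_periodic:
  fixes f :: "real \<Rightarrow> complex"
  assumes cont: "continuous_on UNIV f" and per: "\<And>t. f (t + 1) = f t" and a: "-1 \<le> a" "a \<le> 1"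
  shows "integral {a..a+1} f = integral {0..1} f"
proof -
  have int: "f integrable_on {u..v}" for u v
    by (meson cont continuous_on_subset integrable_continuous_interval top_greatest)
  have shift: "integral {u+1..v+1} f = integral {u..v} f" for u v
    using integral_shift_real_ivl[of "u+1" 1 "v+1" f] per by simp
  have main: "integral {b..b+1} f = integral {0..1} f" if "-1 \<le> b" "b \<le> 0" for b
  proof -
    have "integral {b..b+1} f = integral {b..0} f + integral {0..b+1} f"
      using that by (intro Henstock_Kurzweil_Integration.integral_combine[symmetric] int) auto
    also have "integral {b..0} f = integral {b+1..1} f" using shift[of b 0] by simp
    also have "integral {b+1..1} f + integral {0..b+1} f = integral {0..1} f"
      using that by (subst add.commute, intro Henstock_Kurzweil_Integration.integral_combine int) auto
    finally show ?thesis .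
  qed
  show ?thesis
  proof (cases "a \<le> 0")
    case False
    then show ?thesis using main[of "a - 1"] shift[of "a - 1" a] a by simp
  qed (use main a in auto)
qed

text \<open>The difference of the two winding numbers is \<open>1 / (2 * pi * \<i>)\<close> times
  the integral in \<open>Cauchy_kernel_jump\<close>, so it tends to 1. Being an integer, it equals 1
  as soon as its distance from 1 is less than 1.\<close>

lemma smooth_jordan_curve_winding_jump:
  assumes \<gamma>: "smooth_jordan_curve \<gamma>" and t0: "t0 \<in> {0..1}"
  defines "T \<equiv> vector_derivative \<gamma> (at t0)"
  shows "\<forall>\<^sub>F \<epsilon> in at_right 0.
     \<gamma> t0 + of_real \<epsilon> * (\<i> * T) \<notin> path_image \<gamma> \<and> \<gamma> t0 - of_real \<epsilon> * (\<i> * T) \<notin> path_image \<gamma> \<and>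
     winding_number \<gamma> (\<gamma> t0 + of_real \<epsilon> * (\<i> * T)) = winding_number \<gamma> (\<gamma> t0 - of_real \<epsilon> * (\<i> * T)) + 1"
proof -
  define d where "d = (\<lambda>t. vector_derivative \<gamma> (at t))"
  note path = smooth_jordan_curve_path[OF \<gamma>]
  obtain D2 where D: "\<And>t. (\<gamma> has_vector_derivative d t) (at t)"
    "\<And>t. (d has_vector_derivative D2 t) (at t)" "continuous_on UNIV d" "continuous_on UNIV D2"
    using smooth_jordan_curve_vector_derivative[OF \<gamma>] unfolding d_def by metis
  have d_per: "d (t + 1) = d t" for t
  proof -
    have "((\<lambda>t. \<gamma> (t + 1)) has_vector_derivative d (t + 1)) (at t)"
      using vector_diff_chain_at[of "\<lambda>t. t + 1" 1 t \<gamma> "d (t + 1)"] D(1)[of "t + 1"]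
      by (simp add: o_def has_vector_derivative_add_const)
    moreover have "(\<lambda>t. \<gamma> (t + 1)) = \<gamma>"
      using smooth_jordan_curve_periodic[OF \<gamma>, of _ 1] by auto
    ultimately show ?thesis using D(1) vector_derivative_unique_at by metis
  qed
  define B where "B = {t0 - 1/2..t0 + 1/2}"
  have "bounded (D2 ` B)"
    by (intro compact_imp_bounded compact_continuous_image continuous_on_subset[OF D(4)]) (auto simp: B_def)
  then obtain K where K: "K > 0" "\<And>t. t \<in> B \<Longrightarrow> norm (D2 t) \<le> K"
    by (auto simp: bounded_pos)
  \<comment> \<open>The increment of \<open>d\<close> is the linear term, at most
    \<open>K * \<bar>s\<bar>\<close>, plus a linearization error of at most
    \<open>2 * K * \<bar>s\<bar>\<close>. Inserting this bound into the linearization of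
    \<open>\<gamma>\<close> gives the quadratic estimate with the same \<open>M\<close>.\<close>
  define M where "M = 3 * K"
  have t0B: "t0 \<in> B" by (simp add: B_def)
  have e': "norm (d (t0 + s) - T) \<le> M * \<bar>s\<bar>" if s: "\<bar>s\<bar> \<le> 1/2" for s
  proof -
    have "norm (d (t0 + s) - d t0 - ((t0 + s) - t0) *\<^sub>R D2 t0) \<le> norm ((t0 + s) - t0) * (2 * K)"
    proof (rule vector_differentiable_bound_linearization[where S = B])
      show "(d has_vector_derivative D2 x) (at x within B)" for x
        using D(2) has_vector_derivative_at_within by blast
      show "closed_segment t0 (t0 + s) \<subseteq> B"
        using s by (auto simp: B_def closed_segment_eq_real_ivl split: if_splits)
      show "norm (D2 x - D2 t0) \<le> 2 * K" if "x \<in> B" for x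
        using norm_triangle_ineq4[of "D2 x" "D2 t0"] K(2)[OF that] K(2)[OF t0B] by linarith
    qed (rule t0B)
    then have "norm (d (t0 + s) - T - s *\<^sub>R D2 t0) \<le> 2 * K * \<bar>s\<bar>"
      by (simp add: T_def d_def mult_ac)
    moreover have "norm (s *\<^sub>R D2 t0) \<le> K * \<bar>s\<bar>"
      using mult_right_mono[OF K(2)[OF t0B], of "\<bar>s\<bar>"] by (simp add: mult.commute)
    ultimately show ?thesis
      using norm_triangle_ineq[of "d (t0 + s) - T - s *\<^sub>R D2 t0" "s *\<^sub>R D2 t0"]
      by (simp add: M_def)
  qed
  define \<beta> where "\<beta> = (\<lambda>s. \<gamma> (t0 + s) - \<gamma> t0)"
  have e: "norm (\<beta> s - of_real s * T) \<le> M * s\<^sup>2" if s: "\<bar>s\<bar> \<le> 1/2" for s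
  proof -
    have "norm (\<gamma> (t0 + s) - \<gamma> t0 - ((t0 + s) - t0) *\<^sub>R d t0) \<le> norm ((t0 + s) - t0) * (M * \<bar>s\<bar>)"
    proof (rule vector_differentiable_bound_linearization[where S = "closed_segment t0 (t0 + s)"])
      show "(\<gamma> has_vector_derivative d x) (at x within closed_segment t0 (t0 + s))" for x
        using D(1) has_vector_derivative_at_within by blast
      show "norm (d x - d t0) \<le> M * \<bar>s\<bar>" if "x \<in> closed_segment t0 (t0 + s)" for x
      proof -
        have "\<bar>x - t0\<bar> \<le> \<bar>s\<bar>" using that by (auto simp: closed_segment_eq_real_ivl split: if_splits)
        then have "norm (d x - T) \<le> M * \<bar>x - t0\<bar>" using e'[of "x - t0"] s by simp
        also have "\<dots> \<le> M * \<bar>s\<bar>" using \<open>\<bar>x - t0\<bar> \<le> \<bar>s\<bar>\<close> K(1) by (simp add: M_def)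
        finally show ?thesis by (simp add: T_def d_def)
      qed
    qed auto
    then show ?thesis by (simp add: \<beta>_def T_def d_def scaleR_conv_of_real power2_eq_square mult_ac abs_mult_self_eq)
  qed
  have nz: "\<beta> s \<noteq> 0" if "\<bar>s\<bar> \<le> 1/2" "s \<noteq> 0" for s
  proof
    assume "\<beta> s = 0"
    then have "t0 + s - t0 \<in> \<int>"
      using smooth_jordan_curve_eq_iff[OF \<gamma>, of "t0 + s" t0] by (simp add: \<beta>_def)
    then show False using that by (auto elim!: Ints_cases)
  qed
  have T: "T \<noteq> 0" using \<gamma> by (simp add: smooth_jordan_curve_def T_def)
  have cont: "continuous_on {-1/2..1/2} \<beta>" "continuous_on {-1/2..1/2} (\<lambda>s. d (t0 + s))"
    unfolding \<beta>_def
    by (intro continuous_intros continuous_on_compose2[OF path(6)] continuous_on_compose2[OF D(3)]; simp)+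
  have M: "M \<ge> 0" using K by (simp add: M_def)
  have jump:
    "((\<lambda>\<epsilon>. integral {-1/2..1/2} (\<lambda>s. 2 * \<i> * of_real \<epsilon> * T * d (t0 + s) / ((\<beta> s)\<^sup>2 + (of_real \<epsilon> * T)\<^sup>2)))
           \<longlongrightarrow> 2 * of_real pi * \<i>) (at_right 0)"
    "\<forall>\<^sub>F \<epsilon> in at_right 0. \<forall>s. \<bar>s\<bar> \<le> 1/2 \<longrightarrow> (\<beta> s)\<^sup>2 + (of_real \<epsilon> * T)\<^sup>2 \<noteq> 0"
    using Cauchy_kernel_jump[OF cont T M] e e' nz by blast+
  define zp where "zp = (\<lambda>\<epsilon>::real. \<gamma> t0 + of_real \<epsilon> * (\<i> * T))"
  define zm where "zm = (\<lambda>\<epsilon>::real. \<gamma> t0 - of_real \<epsilon> * (\<i> * T))"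
  \<comment> \<open>This identity turns the lower bound on the denominator into the statement that
    neither \<open>zp \<epsilon>\<close> nor \<open>zm \<epsilon>\<close> lies on the curve, and it
    combines the two Cauchy kernels into one fraction.\<close>
  have prod: "(\<gamma> t - zp \<epsilon>) * (\<gamma> t - zm \<epsilon>) = (\<gamma> t - \<gamma> t0)\<^sup>2 + (of_real \<epsilon> * T)\<^sup>2" for t \<epsilon>
    by (simp add: zp_def zm_def power2_eq_square algebra_simps)
  have off: "\<forall>\<^sub>F \<epsilon> in at_right 0. \<forall>t. \<gamma> t \<noteq> zp \<epsilon> \<and> \<gamma> t \<noteq> zm \<epsilon>"
    using jump(2)
  proof eventually_elim
    case (elim \<epsilon>)
    show ?case
    proof
      fix t
      \<comment> \<open>The denominator is controlled only for
        \<open>\<bar>s\<bar> \<le> 1/2\<close>; subtracting the nearest integer brings any parameter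
        into this range without moving the point on the curve.\<close>
      define s where "s = t - t0 - of_int (round (t - t0))"
      have s: "\<bar>s\<bar> \<le> 1/2"
        using of_int_round_abs_le[of "t - t0"] by (simp add: s_def abs_minus_commute)
      have "\<gamma> t = \<gamma> (t0 + s)"
        by (subst smooth_jordan_curve_eq_iff[OF \<gamma>]) (simp add: s_def)
      then have "(\<gamma> t - zp \<epsilon>) * (\<gamma> t - zm \<epsilon>) \<noteq> 0"
        using elim s by (simp add: prod \<beta>_def)
      then show "\<gamma> t \<noteq> zp \<epsilon> \<and> \<gamma> t \<noteq> zm \<epsilon>" by auto
    qed
  qed
  have wn: "winding_number \<gamma> z = 1 / (2 * of_real pi * \<i>) * integral {-1/2..1/2} (\<lambda>s. d (t0 + s) / (\<gamma> (t0 + s) - z))"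
    and wint: "(\<lambda>s. d (t0 + s) / (\<gamma> (t0 + s) - z)) integrable_on {-1/2..1/2}"
    if z: "\<forall>t. \<gamma> t \<noteq> z" for z
  proof -
    define f where "f = (\<lambda>t. d t / (\<gamma> t - z))"
    have contf: "continuous_on UNIV f"
      unfolding f_def using z by (intro continuous_intros path D) auto
    have "f (t + 1) = f t" for t
      using d_per smooth_jordan_curve_periodic[OF \<gamma>, of t 1] by (simp add: f_def)
    then have "integral {(t0 - 1/2)..(t0 - 1/2) + 1} f = integral {0..1} f"
      using t0 by (intro integral_periodic contf) auto
    moreover have "integral {-1/2..1/2} (\<lambda>s. f (t0 + s)) = integral {(t0 - 1/2)..(t0 - 1/2) + 1} f"
      using integral_shift_real_ivl[of "t0 - 1/2" t0 "t0 + 1/2" f] by (simp add: add.commute)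
    moreover have "contour_integral \<gamma> (\<lambda>w. 1 / (w - z)) = integral {0..1} f"
      by (simp add: contour_integral_integral f_def d_def)
    moreover have "z \<notin> path_image \<gamma>" using z path(4) by auto
    ultimately show "winding_number \<gamma> z = 1 / (2 * of_real pi * \<i>) * integral {-1/2..1/2} (\<lambda>s. d (t0 + s) / (\<gamma> (t0 + s) - z))"
      using winding_number_valid_path[OF path(1)] by (simp add: f_def)
    have "continuous_on {-1/2..1/2} (\<lambda>s. f (t0 + s))"
      by (intro continuous_intros continuous_on_compose2[OF contf]) auto
    then show "(\<lambda>s. d (t0 + s) / (\<gamma> (t0 + s) - z)) integrable_on {-1/2..1/2}"
      unfolding f_def by (rule integrable_continuous_interval)
  qed
  have "((\<lambda>\<epsilon>. 1 / (2 * of_real pi * \<i>) * integral {-1/2..1/2} (\<lambda>s. 2 * \<i> * of_real \<epsilon> * T * d (t0 + s) / ((\<beta> s)\<^sup>2 + (of_real \<epsilon> * T)\<^sup>2)))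
           \<longlongrightarrow> 1 / (2 * of_real pi * \<i>) * (2 * of_real pi * \<i>)) (at_right 0)"
    by (intro tendsto_intros jump(1))
  moreover have "\<forall>\<^sub>F \<epsilon> in at_right 0. 1 / (2 * of_real pi * \<i>) *
      integral {-1/2..1/2} (\<lambda>s. 2 * \<i> * of_real \<epsilon> * T * d (t0 + s) / ((\<beta> s)\<^sup>2 + (of_real \<epsilon> * T)\<^sup>2)) =
      winding_number \<gamma> (zp \<epsilon>) - winding_number \<gamma> (zm \<epsilon>)"
    using off
  proof eventually_elim
    case (elim \<epsilon>)
    have "2 * \<i> * of_real \<epsilon> * T * d (t0 + s) / ((\<beta> s)\<^sup>2 + (of_real \<epsilon> * T)\<^sup>2) =
        d (t0 + s) / (\<gamma> (t0 + s) - zp \<epsilon>) - d (t0 + s) / (\<gamma> (t0 + s) - zm \<epsilon>)" for s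
    proof -
      have nz2: "\<gamma> (t0 + s) - zp \<epsilon> \<noteq> 0" "\<gamma> (t0 + s) - zm \<epsilon> \<noteq> 0" using elim by auto
      have "zp \<epsilon> - zm \<epsilon> = 2 * \<i> * of_real \<epsilon> * T" by (simp add: zp_def zm_def)
      moreover have "d (t0 + s) / (\<gamma> (t0 + s) - zp \<epsilon>) - d (t0 + s) / (\<gamma> (t0 + s) - zm \<epsilon>) =
          (zp \<epsilon> - zm \<epsilon>) * d (t0 + s) / ((\<gamma> (t0 + s) - zp \<epsilon>) * (\<gamma> (t0 + s) - zm \<epsilon>))"
        using nz2 by (simp add: diff_frac_eq) (simp add: algebra_simps)
      ultimately show ?thesis by (simp add: prod \<beta>_def)
    qed
    then have "integral {-1/2..1/2} (\<lambda>s. 2 * \<i> * of_real \<epsilon> * T * d (t0 + s) / ((\<beta> s)\<^sup>2 + (of_real \<epsilon> * T)\<^sup>2)) =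
        integral {-1/2..1/2} (\<lambda>s. d (t0 + s) / (\<gamma> (t0 + s) - zp \<epsilon>) - d (t0 + s) / (\<gamma> (t0 + s) - zm \<epsilon>))"
      by presburger
    also have "\<dots> = integral {-1/2..1/2} (\<lambda>s. d (t0 + s) / (\<gamma> (t0 + s) - zp \<epsilon>)) -
                    integral {-1/2..1/2} (\<lambda>s. d (t0 + s) / (\<gamma> (t0 + s) - zm \<epsilon>))"
      using elim by (intro integral_diff wint) auto
    finally show ?case
      using wn[of "zp \<epsilon>"] wn[of "zm \<epsilon>"] elim by (simp add: right_diff_distrib)
  qed
  ultimately have "((\<lambda>\<epsilon>. winding_number \<gamma> (zp \<epsilon>) - winding_number \<gamma> (zm \<epsilon>)) \<longlongrightarrow>
      1 / (2 * of_real pi * \<i>) * (2 * of_real pi * \<i>)) (at_right 0)"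
    by (rule Lim_transform_eventually)
  then have "((\<lambda>\<epsilon>. winding_number \<gamma> (zp \<epsilon>) - winding_number \<gamma> (zm \<epsilon>)) \<longlongrightarrow> 1) (at_right 0)" by simp
  then have "\<forall>\<^sub>F \<epsilon> in at_right 0. dist (winding_number \<gamma> (zp \<epsilon>) - winding_number \<gamma> (zm \<epsilon>)) 1 < 1"
    by (rule tendstoD) simp
  with off show ?thesis
  proof eventually_elim
    case (elim \<epsilon>)
    have off: "zp \<epsilon> \<notin> path_image \<gamma>" "zm \<epsilon> \<notin> path_image \<gamma>" using elim(1) path(4) by auto
    then have "winding_number \<gamma> (zp \<epsilon>) - winding_number \<gamma> (zm \<epsilon>) - 1 \<in> \<int>"
      using integer_winding_number[OF path(2,3)] by (intro Ints_diff) auto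
    moreover have "norm (winding_number \<gamma> (zp \<epsilon>) - winding_number \<gamma> (zm \<epsilon>) - 1) < 1"
      using elim(2) by (simp add: dist_norm)
    ultimately have "winding_number \<gamma> (zp \<epsilon>) - winding_number \<gamma> (zm \<epsilon>) - 1 = 0"
      by (elim Ints_cases) (simp only: norm_of_int, auto)
    then show ?case using off by (simp add: zp_def zm_def algebra_simps)
  qed
qed

subsection \<open>Winding numbers and Cauchy transforms of the boundary\<close>

text \<open>The other boundary curves avoid the point \<open>\<gamma> t0\<close>, so their winding
  numbers are constant near it and only \<open>\<gamma>\<close> contributes to the jump. Nothing is
  said yet about which side of the frontier \<open>zm \<epsilon>\<close> lies on.\<close>

lemma boundary_winding_jump:
  assumes pos: "positive_boundary_param \<Omega> \<Gamma>" and \<gamma>: "\<gamma> \<in> \<Gamma>" and t0: "t0 \<in> {0..1}"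
  defines "zp \<equiv> \<lambda>\<epsilon>. \<gamma> t0 + of_real \<epsilon> * (\<i> * vector_derivative \<gamma> (at t0))"
    and "zm \<equiv> \<lambda>\<epsilon>. \<gamma> t0 - of_real \<epsilon> * (\<i> * vector_derivative \<gamma> (at t0))"
  shows "\<forall>\<^sub>F \<epsilon> in at_right 0. zp \<epsilon> \<in> \<Omega> \<and> zm \<epsilon> \<notin> frontier \<Omega> \<and>
    (\<Sum>\<delta>\<in>\<Gamma>. winding_number \<delta> (zp \<epsilon>)) = (\<Sum>\<delta>\<in>\<Gamma>. winding_number \<delta> (zm \<epsilon>)) + 1"
proof -
  have fin: "finite \<Gamma>" and smooth: "\<And>\<delta>. \<delta> \<in> \<Gamma> \<Longrightarrow> smooth_jordan_curve \<delta>"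
    and fr: "frontier \<Omega> = (\<Union>\<gamma>\<in>\<Gamma>. path_image \<gamma>)"
    and disj: "pairwise (\<lambda>\<gamma> \<delta>. disjnt (path_image \<gamma>) (path_image \<delta>)) \<Gamma>"
    and left: "\<forall>\<^sub>F \<epsilon> in at_right 0. zp \<epsilon> \<in> \<Omega>"
    using pos \<gamma> by (auto simp: positive_boundary_param_def zp_def)
  have lim: "(zp \<longlongrightarrow> \<gamma> t0) (at_right 0)" "(zm \<longlongrightarrow> \<gamma> t0) (at_right 0)"
  proof -
    have "(zp \<longlongrightarrow> \<gamma> t0 + of_real 0 * (\<i> * vector_derivative \<gamma> (at t0))) (at_right 0)"
      "(zm \<longlongrightarrow> \<gamma> t0 - of_real 0 * (\<i> * vector_derivative \<gamma> (at t0))) (at_right 0)"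
      unfolding zp_def zm_def by (intro tendsto_intros)+
    then show "(zp \<longlongrightarrow> \<gamma> t0) (at_right 0)" "(zm \<longlongrightarrow> \<gamma> t0) (at_right 0)" by simp_all
  qed
  have "\<forall>\<^sub>F \<epsilon> in at_right 0. \<forall>\<delta>\<in>\<Gamma>-{\<gamma>}. zm \<epsilon> \<notin> path_image \<delta> \<and>
          winding_number \<delta> (zp \<epsilon>) = winding_number \<delta> (zm \<epsilon>)"
  proof (rule eventually_ball_finite)
    show "\<forall>\<delta>\<in>\<Gamma>-{\<gamma>}. \<forall>\<^sub>F \<epsilon> in at_right 0. zm \<epsilon> \<notin> path_image \<delta> \<and>
          winding_number \<delta> (zp \<epsilon>) = winding_number \<delta> (zm \<epsilon>)"
    proof
      fix \<delta> assume \<delta>: "\<delta> \<in> \<Gamma> - {\<gamma>}"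
      define U where "U = {z. z \<notin> path_image \<delta> \<and> winding_number \<delta> z = winding_number \<delta> (\<gamma> t0)}"
      note path = smooth_jordan_curve_path[OF smooth[of \<delta>]]
      have "open U" unfolding U_def using path \<delta> by (intro open_winding_number_levelsets) auto
      have "\<gamma> t0 \<in> path_image \<gamma>" using t0 by (auto simp: path_image_def)
      moreover have "disjnt (path_image \<gamma>) (path_image \<delta>)" using disj \<delta> \<gamma> by (auto simp: pairwise_def)
      ultimately have "\<gamma> t0 \<in> U" by (auto simp: U_def disjnt_def)
      then have "\<forall>\<^sub>F \<epsilon> in at_right 0. zp \<epsilon> \<in> U" "\<forall>\<^sub>F \<epsilon> in at_right 0. zm \<epsilon> \<in> U"
        using lim \<open>open U\<close> by (auto dest: topological_tendstoD)
      then show "\<forall>\<^sub>F \<epsilon> in at_right 0. zm \<epsilon> \<notin> path_image \<delta> \<and>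
          winding_number \<delta> (zp \<epsilon>) = winding_number \<delta> (zm \<epsilon>)"
        by eventually_elim (simp add: U_def)
    qed
  qed (use fin in auto)
  with left smooth_jordan_curve_winding_jump[OF smooth[OF \<gamma>] t0] show ?thesis
  proof eventually_elim
    case (elim \<epsilon>)
    have "(\<Sum>\<delta>\<in>\<Gamma>. winding_number \<delta> (zp \<epsilon>)) =
        winding_number \<gamma> (zp \<epsilon>) + (\<Sum>\<delta>\<in>\<Gamma>-{\<gamma>}. winding_number \<delta> (zp \<epsilon>))"
      using fin \<gamma> by (rule sum.remove)
    also have "\<dots> = winding_number \<gamma> (zm \<epsilon>) + 1 + (\<Sum>\<delta>\<in>\<Gamma>-{\<gamma>}. winding_number \<delta> (zm \<epsilon>))"
      using elim by (simp add: zp_def zm_def)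
    also have "\<dots> = (\<Sum>\<delta>\<in>\<Gamma>. winding_number \<delta> (zm \<epsilon>)) + 1"
      using sum.remove[OF fin \<gamma>, of "\<lambda>\<delta>. winding_number \<delta> (zm \<epsilon>)"] by simp
    finally show ?case using elim by (auto simp: fr zm_def)
  qed
qed

text \<open>The total winding number is constant on the connected set \<open>\<Omega>\<close>, which
  the curves avoid, and one suitable boundary point fixes its value as 1. The jump then makes it 0
  just to the right of every boundary curve, so such points cannot belong to
  \<open>\<Omega>\<close>; the vector \<open>v\<close> is the right-hand normal.\<close>

lemma boundary_winding:
  assumes \<Omega>: "open \<Omega>" "connected \<Omega>" "bounded \<Omega>" "\<Omega> \<noteq> {}" and pos: "positive_boundary_param \<Omega> \<Gamma>"
  shows "\<And>z. z \<in> \<Omega> \<Longrightarrow> (\<Sum>\<gamma>\<in>\<Gamma>. winding_number \<gamma> z) = 1"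
    and "\<And>x. x \<in> frontier \<Omega> \<Longrightarrow> \<exists>v. v \<noteq> 0 \<and> (\<forall>\<^sub>F \<epsilon> in at_right 0.
           x + of_real \<epsilon> * v \<notin> closure \<Omega> \<and> (\<Sum>\<gamma>\<in>\<Gamma>. winding_number \<gamma> (x + of_real \<epsilon> * v)) = 0)"
proof -
  have fin: "finite \<Gamma>" and smooth: "\<And>\<delta>. \<delta> \<in> \<Gamma> \<Longrightarrow> smooth_jordan_curve \<delta>"
    and fr: "frontier \<Omega> = (\<Union>\<gamma>\<in>\<Gamma>. path_image \<gamma>)"
    using pos by (auto simp: positive_boundary_param_def)
  note path = smooth_jordan_curve_path[OF smooth]
  have frontier: "frontier \<Omega> = closure \<Omega> - \<Omega>" using \<Omega> by (simp add: frontier_def interior_open)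
  define N where "N = (\<lambda>z. \<Sum>\<gamma>\<in>\<Gamma>. winding_number \<gamma> z)"
  have const: "N z = N w" if "z \<in> \<Omega>" "w \<in> \<Omega>" for z w
    unfolding N_def
  proof (rule sum.cong)
    fix \<gamma> assume "\<gamma> \<in> \<Gamma>"
    moreover have "\<Omega> \<inter> path_image \<gamma> = {}" using fr frontier \<open>\<gamma> \<in> \<Gamma>\<close> by blast
    ultimately show "winding_number \<gamma> z = winding_number \<gamma> w"
      using that \<Omega> path by (intro winding_number_eq[of \<gamma> z \<Omega>]) auto
  qed simp
  txt \<open>The value on \<open>\<Omega>\<close> is found at a rightmost boundary point, next to which a half-plane with
    winding number \<open>0\<close> lies on the right-hand side of the curve.\<close>
  have "compact (closure \<Omega>)" "closure \<Omega> \<noteq> {}" using \<Omega> by auto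
  then obtain x where x: "x \<in> closure \<Omega>" "\<And>y. y \<in> closure \<Omega> \<Longrightarrow> Re y \<le> Re x"
    using continuous_attains_sup[of "closure \<Omega>" Re, OF _ _ continuous_on_Re[OF continuous_on_id]] by auto
  have "x \<notin> \<Omega>"
  proof
    assume "x \<in> \<Omega>"
    then obtain r where r: "r > 0" "cball x r \<subseteq> \<Omega>" using \<Omega>(1) open_contains_cball by blast
    then have "x + of_real r \<in> closure \<Omega>" using closure_subset by (fastforce simp: dist_norm)
    then show False using x(2)[of "x + of_real r"] r by simp
  qed
  then obtain \<gamma> t0 where \<gamma>: "\<gamma> \<in> \<Gamma>" "t0 \<in> {0..1}" "x = \<gamma> t0"
    using x(1) fr unfolding frontier path_image_def by blast
  define T where "T = vector_derivative \<gamma> (at t0)"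
  obtain D2 where D: "\<And>t. (\<gamma> has_vector_derivative vector_derivative \<gamma> (at t)) (at t)"
    using smooth_jordan_curve_vector_derivative[OF smooth[OF \<gamma>(1)]] by metis
  have "((\<lambda>t. Re (\<gamma> t)) has_real_derivative Re T) (at t0)"
    using D[of t0] unfolding T_def has_real_derivative_iff_has_vector_derivative
    by (rule bounded_linear.has_vector_derivative[OF bounded_linear_Re])
  moreover have "Re (\<gamma> t) \<le> Re (\<gamma> t0)" for t
    using x(2)[of "\<gamma> t"] \<gamma>(1,3) fr path(4)[OF \<gamma>(1)] unfolding frontier by blast
  ultimately have "Re T = 0" by (intro DERIV_local_max[of _ _ t0 1]) auto
  have "T \<noteq> 0" using smooth[OF \<gamma>(1)] by (simp add: smooth_jordan_curve_def T_def)
  have "\<forall>\<^sub>F \<epsilon>::real in at_right 0. \<epsilon> > 0" by (rule eventually_at_right_less)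
  with boundary_winding_jump[OF pos \<gamma>(1,2)]
  have "\<forall>\<^sub>F \<epsilon> in at_right 0. \<epsilon> > 0 \<and> \<gamma> t0 + of_real \<epsilon> * (\<i> * T) \<in> \<Omega> \<and>
    N (\<gamma> t0 + of_real \<epsilon> * (\<i> * T)) = N (\<gamma> t0 - of_real \<epsilon> * (\<i> * T)) + 1"
    by eventually_elim (simp add: T_def N_def)
  then obtain \<epsilon> where \<epsilon>: "\<epsilon> > 0" "\<gamma> t0 + of_real \<epsilon> * (\<i> * T) \<in> \<Omega>"
      "N (\<gamma> t0 + of_real \<epsilon> * (\<i> * T)) = N (\<gamma> t0 - of_real \<epsilon> * (\<i> * T)) + 1"
    using eventually_happens'[OF trivial_limit_at_right_real] by blast
  \<comment> \<open>The left normal \<open>\<i> * T\<close> has real part \<open>- Im T\<close>. It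
    leads into \<open>\<Omega>\<close> and hence cannot increase the real part beyond its maximum;
    so \<open>- \<i> * T\<close> leads into the half-plane beyond \<open>x\<close>.\<close>
  have "Re (\<gamma> t0 + of_real \<epsilon> * (\<i> * T)) \<le> Re x" using \<epsilon>(2) x(2) closure_subset by blast
  then have "Im T \<ge> 0" using \<epsilon>(1) \<gamma>(3) by (simp add: zero_le_mult_iff)
  with \<open>Re T = 0\<close> \<open>T \<noteq> 0\<close> have ImT: "Im T > 0" by (simp add: complex_eq_iff)
  have "N (\<gamma> t0 - of_real \<epsilon> * (\<i> * T)) = 0"
    unfolding N_def
  proof (intro sum.neutral ballI winding_number_zero_outside)
    fix \<delta> assume \<delta>: "\<delta> \<in> \<Gamma>"
    show "path_image \<delta> \<subseteq> {z. Re z \<le> Re x}" using x(2) fr frontier \<delta> by auto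
    show "\<gamma> t0 - of_real \<epsilon> * (\<i> * T) \<notin> {z. Re z \<le> Re x}" using ImT \<epsilon>(1) \<gamma>(3) by (simp add: not_le)
  qed (use path convex_halfspace_Re_le in auto)
  then have one: "N z = 1" if "z \<in> \<Omega>" for z using const[OF that \<epsilon>(2)] \<epsilon>(3) by simp
  then show "\<And>z. z \<in> \<Omega> \<Longrightarrow> (\<Sum>\<gamma>\<in>\<Gamma>. winding_number \<gamma> z) = 1" by (simp add: N_def)
  fix y assume "y \<in> frontier \<Omega>"
  then obtain \<delta> s where \<delta>: "\<delta> \<in> \<Gamma>" "s \<in> {0..1}" "y = \<delta> s" using fr by (auto simp: path_image_def)
  define v where "v = - (\<i> * vector_derivative \<delta> (at s))"
  have "v \<noteq> 0" using smooth[OF \<delta>(1)] by (simp add: smooth_jordan_curve_def v_def)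
  moreover have "\<forall>\<^sub>F \<epsilon> in at_right 0. y + of_real \<epsilon> * v \<notin> closure \<Omega> \<and> N (y + of_real \<epsilon> * v) = 0"
    using boundary_winding_jump[OF pos \<delta>(1,2)]
  proof eventually_elim
    case (elim \<epsilon>)
    define z where "z = \<delta> s - of_real \<epsilon> * (\<i> * vector_derivative \<delta> (at s))"
    have "N z = 0" using elim one by (auto simp: N_def z_def)
    then have "z \<notin> closure \<Omega>" using elim one[of z] frontier by (auto simp: z_def)
    moreover have "y + of_real \<epsilon> * v = z" using \<delta>(3) by (simp add: z_def v_def)
    ultimately show ?case using \<open>N z = 0\<close> by simp
  qed
  ultimately show "\<exists>v. v \<noteq> 0 \<and> (\<forall>\<^sub>F \<epsilon> in at_right 0.
           y + of_real \<epsilon> * v \<notin> closure \<Omega> \<and> (\<Sum>\<gamma>\<in>\<Gamma>. winding_number \<gamma> (y + of_real \<epsilon> * v)) = 0)"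
    unfolding N_def by blast
qed

section \<open>Cauchy transforms and their boundary values\<close>

lemma contour_integrable_continuous_smooth_jordan:
  assumes "smooth_jordan_curve \<gamma>" "continuous_on (path_image \<gamma>) f"
  shows "f contour_integrable_on \<gamma>"
proof -
  note path = smooth_jordan_curve_path[OF assms(1)]
  have "continuous_on {0..1} (\<lambda>t. f (\<gamma> t) * vector_derivative \<gamma> (at t))"
    by (intro continuous_intros continuous_on_compose2[OF assms(2)]
        continuous_on_subset[OF path(5)] continuous_on_subset[OF path(6)]) (auto simp: path(4))
  then show ?thesis unfolding contour_integrable_on by (rule integrable_continuous_interval)
qed

lemma Cauchy_transform_holomorphic:
  assumes "smooth_jordan_curve \<gamma>" "continuous_on (path_image \<gamma>) \<phi>"
  shows "(\<lambda>z. contour_integral \<gamma> (\<lambda>u. \<phi> u / (u - z))) holomorphic_on - path_image \<gamma>"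
proof -
  note path = smooth_jordan_curve_path[OF assms(1)]
  have "bounded ((\<lambda>t. vector_derivative \<gamma> (at t)) ` {0..1})"
    by (intro compact_imp_bounded compact_continuous_image continuous_on_subset[OF path(5)]) auto
  then obtain B where B: "\<And>t. t \<in> {0..1} \<Longrightarrow> norm (vector_derivative \<gamma> (at t)) \<le> B"
    unfolding bounded_iff by blast
  \<comment> \<open>The exponent 1 is written out to match the general rule for differentiating
    \<open>\<phi> u / (u - w) ^ k\<close> under the integral.\<close>
  have int: "((\<lambda>u. \<phi> u / (u - w) ^ 1) has_contour_integral contour_integral \<gamma> (\<lambda>u. \<phi> u / (u - w))) \<gamma>"
    if "w \<in> UNIV - path_image \<gamma>" for w
  proof -
    have "(\<lambda>u. \<phi> u / (u - w)) contour_integrable_on \<gamma>"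
      by (intro contour_integrable_continuous_smooth_jordan assms continuous_intros) (use that in auto)
    then show ?thesis by (simp add: has_contour_integral_integral)
  qed
  show ?thesis
    unfolding holomorphic_on_def field_differentiable_def
  proof
    fix w assume w: "w \<in> - path_image \<gamma>"
    have "((\<lambda>z. contour_integral \<gamma> (\<lambda>u. \<phi> u / (u - z))) has_field_derivative
        of_nat 1 * contour_integral \<gamma> (\<lambda>u. \<phi> u / (u - w) ^ Suc 1)) (at w)"
      by (rule Cauchy_next_derivative(2)[OF assms(2) B int _ open_UNIV path(1)]) (use w in auto)
    then show "\<exists>f'. ((\<lambda>z. contour_integral \<gamma> (\<lambda>u. \<phi> u / (u - z))) has_field_derivative f')
        (at w within - path_image \<gamma>)"
      using has_field_derivative_at_within by blast
  qed
qed

text \<open>Subtracting \<open>\<phi> z\<close> times the winding number leaves the kernel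
  \<open>(\<phi> u - \<phi> z) / (u - z)\<close>, which the Lipschitz constant dominates.\<close>

lemma Cauchy_transform_limit:
  assumes \<gamma>: "smooth_jordan_curve \<gamma>" and lip: "L-lipschitz_on X \<phi>"
    and X: "path_image \<gamma> \<subseteq> X" "x \<in> X"
  shows "\<exists>l. ((\<lambda>z. contour_integral \<gamma> (\<lambda>u. \<phi> u / (u - z)) - 2 * of_real pi * \<i> * \<phi> z * winding_number \<gamma> z)
           \<longlongrightarrow> l) (at x within X - path_image \<gamma>)"
proof -
  note path = smooth_jordan_curve_path[OF \<gamma>]
  have cont\<phi>: "continuous_on X \<phi>" using lip by (rule lipschitz_on_continuous_on)
  define d where "d = (\<lambda>t. vector_derivative \<gamma> (at t))"
  \<comment> \<open>These are the parameters at which the kernel degenerates when \<open>z\<close>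
    reaches \<open>x\<close>. By periodicity and injectivity they differ by integers, so there are
    finitely many.\<close>
  define F where "F = {t\<in>{0..1}. \<gamma> t = x}"
  have "finite F"
  proof (cases "F = {}")
    case False
    then obtain t1 where t1: "t1 \<in> F" by blast
    have "F \<subseteq> {t1 - 1, t1, t1 + 1}"
    proof
      fix t assume t: "t \<in> F"
      then have "t - t1 \<in> \<int>" using t1 smooth_jordan_curve_eq_iff[OF \<gamma>, of t t1] by (simp add: F_def)
      then obtain n where n: "t - t1 = of_int n" by (auto elim: Ints_cases)
      moreover have "\<bar>t - t1\<bar> \<le> 1" using t t1 by (auto simp: F_def)
      ultimately have "n = -1 \<or> n = 0 \<or> n = 1" by linarith
      then show "t \<in> {t1 - 1, t1, t1 + 1}" using n by auto
    qed
    then show ?thesis by (rule finite_subset) simp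
  qed simp
  then have negl: "negligible F" by (rule negligible_finite)
  \<comment> \<open>Setting the kernel to 0 on the null set \<open>F\<close>, for every
    \<open>z\<close>, changes no integral and makes it converge at every parameter as
    \<open>z\<close> tends to \<open>x\<close>, including the case \<open>z = x\<close>.\<close>
  define k where "k = (\<lambda>z t. if t \<in> F then 0 else (\<phi> (\<gamma> t) - \<phi> z) / (\<gamma> t - z) * d t)"
  have eq: "contour_integral \<gamma> (\<lambda>u. \<phi> u / (u - z)) - 2 * of_real pi * \<i> * \<phi> z * winding_number \<gamma> z =
              integral {0..1} (k z)"
    and int: "k z integrable_on {0..1}" if z: "z \<in> X - path_image \<gamma>" for z
  proof -
    have nz: "\<gamma> t \<noteq> z" for t using z path(4) by auto
    have c: "continuous_on {0..1} (\<lambda>t. (\<phi> (\<gamma> t) - \<phi> z) / (\<gamma> t - z) * d t)"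
      unfolding d_def using nz X path(4)
      by (intro continuous_intros continuous_on_compose2[OF cont\<phi>]
        continuous_on_subset[OF path(5)] continuous_on_subset[OF path(6)]) auto
    show "k z integrable_on {0..1}"
      by (rule integrable_spike[OF integrable_continuous_interval[OF c] negl]) (simp add: k_def)
    have 1: "(\<lambda>u. \<phi> u / (u - z)) contour_integrable_on \<gamma>" "(\<lambda>u. 1 / (u - z)) contour_integrable_on \<gamma>"
      using z X by (intro contour_integrable_continuous_smooth_jordan \<gamma> continuous_intros
          continuous_on_subset[OF cont\<phi>]; auto)+
    have "contour_integral \<gamma> (\<lambda>u. \<phi> u / (u - z)) - \<phi> z * contour_integral \<gamma> (\<lambda>u. 1 / (u - z)) =
        contour_integral \<gamma> (\<lambda>u. \<phi> u / (u - z) - \<phi> z * (1 / (u - z)))"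
      unfolding contour_integral_lmul[OF 1(2), symmetric]
      by (rule contour_integral_diff[OF 1(1) contour_integrable_lmul[OF 1(2)], symmetric])
    also have "\<dots> = integral {0..1} (\<lambda>t. (\<phi> (\<gamma> t) - \<phi> z) / (\<gamma> t - z) * d t)"
      by (simp add: contour_integral_integral d_def diff_divide_distrib)
    also have "\<dots> = integral {0..1} (k z)"
      by (rule integral_spike[OF negl]) (simp add: k_def)
    finally have "contour_integral \<gamma> (\<lambda>u. \<phi> u / (u - z)) - \<phi> z * contour_integral \<gamma> (\<lambda>u. 1 / (u - z)) =
        integral {0..1} (k z)" .
    moreover have "contour_integral \<gamma> (\<lambda>u. 1 / (u - z)) = 2 * of_real pi * \<i> * winding_number \<gamma> z"
      using winding_number_valid_path[OF path(1), of z] z by simp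
    ultimately show "contour_integral \<gamma> (\<lambda>u. \<phi> u / (u - z)) - 2 * of_real pi * \<i> * \<phi> z * winding_number \<gamma> z =
              integral {0..1} (k z)"
      by (simp only: mult_ac)
  qed
  have "bounded (d ` {0..1})" unfolding d_def
    by (intro compact_imp_bounded compact_continuous_image continuous_on_subset[OF path(5)]) auto
  then obtain B where B: "\<And>t. t \<in> {0..1} \<Longrightarrow> norm (d t) \<le> B"
    unfolding bounded_iff by blast
  have L: "L \<ge> 0" using lip by (rule lipschitz_on_nonneg)
  have bound: "norm (k z t) \<le> L * B" if "z \<in> X - path_image \<gamma>" "t \<in> {0..1}" for z t
  proof (cases "t \<in> F")
    case False
    have "norm (\<phi> (\<gamma> t) - \<phi> z) \<le> L * norm (\<gamma> t - z)"
      using lipschitz_onD[OF lip, of "\<gamma> t" z] that X path(4) by (auto simp: dist_norm)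
    moreover have "\<gamma> t \<noteq> z" using that path(4) by auto
    ultimately have "norm ((\<phi> (\<gamma> t) - \<phi> z) / (\<gamma> t - z)) \<le> L"
      by (simp add: norm_divide divide_simps)
    then have "norm ((\<phi> (\<gamma> t) - \<phi> z) / (\<gamma> t - z)) * norm (d t) \<le> L * B"
      using B[OF that(2)] L by (intro mult_mono) auto
    then show ?thesis using False by (simp only: k_def norm_mult if_False)
  next
    case True
    have "0 \<le> B" using B[OF that(2)] norm_ge_zero order_trans by blast
    then show ?thesis using L True by (simp add: k_def)
  qed
  have "((\<lambda>z. integral {0..1} (k z)) \<longlongrightarrow> integral {0..1} (k x)) (at x within X - path_image \<gamma>)"
    unfolding tendsto_at_iff_sequentially comp_def
  proof (intro allI impI)
    fix Z assume Z: "\<forall>i. Z i \<in> X - path_image \<gamma> - {x}" "Z \<longlonglongrightarrow> x"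
    show "(\<lambda>i. integral {0..1} (k (Z i))) \<longlonglongrightarrow> integral {0..1} (k x)"
    proof (rule dominated_convergence(2)[where h = "\<lambda>_. L * B"])
      fix t :: real assume t: "t \<in> {0..1}"
      have "(\<lambda>i. \<phi> (Z i)) \<longlonglongrightarrow> \<phi> x"
        using Z X(2) by (intro continuous_on_tendsto_compose[OF cont\<phi>]) auto
      then show "(\<lambda>i. k (Z i) t) \<longlonglongrightarrow> k x t"
        using t Z(2) by (auto simp: k_def F_def intro!: tendsto_intros)
    qed (use Z int bound in auto)
  qed
  then have "((\<lambda>z. contour_integral \<gamma> (\<lambda>u. \<phi> u / (u - z)) - 2 * of_real pi * \<i> * \<phi> z * winding_number \<gamma> z)
           \<longlongrightarrow> integral {0..1} (k x)) (at x within X - path_image \<gamma>)"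
    by (rule Lim_transform_eventually) (auto simp: eventually_at_filter eq)
  then show ?thesis by blast
qed

text \<open>\<open>D\<close>, the Cauchy transform corrected by the winding number, has one and the
  same limit at a boundary point from both sides. Outside the closure the transform is
  \<open>Q\<close>, and along the outer normal the winding number is 0, so this limit is
  \<open>Q x\<close>; inside the winding number is 1, and solving for the transform gives the
  boundary values of \<open>H\<close>.\<close>

lemma Cauchy_transform_boundary_values:
  assumes \<Omega>: "open \<Omega>" "connected \<Omega>" "bounded \<Omega>" "\<Omega> \<noteq> {}" and pos: "positive_boundary_param \<Omega> \<Gamma>"
    and lip: "L-lipschitz_on X \<phi>" and X: "open X" "closure \<Omega> \<subseteq> X"
    and outside: "\<And>z. z \<notin> closure \<Omega> \<Longrightarrow> (\<Sum>\<gamma>\<in>\<Gamma>. contour_integral \<gamma> (\<lambda>u. \<phi> u / (u - z))) = Q z"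
    and contQ: "\<And>x. x \<in> frontier \<Omega> \<Longrightarrow> isCont Q x"
  obtains H where "H holomorphic_on \<Omega>" "continuous_on (closure \<Omega>) H"
    "\<And>x. x \<in> frontier \<Omega> \<Longrightarrow> H x = \<phi> x + Q x / (2 * of_real pi * \<i>)"
proof -
  have fin: "finite \<Gamma>" and smooth: "\<And>\<delta>. \<delta> \<in> \<Gamma> \<Longrightarrow> smooth_jordan_curve \<delta>"
    and fr: "frontier \<Omega> = (\<Union>\<gamma>\<in>\<Gamma>. path_image \<gamma>)"
    using pos by (auto simp: positive_boundary_param_def)
  have frontier: "frontier \<Omega> = closure \<Omega> - \<Omega>" using \<Omega> by (simp add: frontier_def interior_open)
  have cont\<phi>: "continuous_on X \<phi>" using lip by (rule lipschitz_on_continuous_on)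
  define C where "C = (\<lambda>z. \<Sum>\<gamma>\<in>\<Gamma>. contour_integral \<gamma> (\<lambda>u. \<phi> u / (u - z)))"
  define N where "N = (\<lambda>z. \<Sum>\<gamma>\<in>\<Gamma>. winding_number \<gamma> z)"
  define D where "D = (\<lambda>z. C z - 2 * of_real pi * \<i> * \<phi> z * N z)"
  have sub: "path_image \<gamma> \<subseteq> frontier \<Omega>" "path_image \<gamma> \<subseteq> X" if "\<gamma> \<in> \<Gamma>" for \<gamma>
    using that fr frontier X by auto
  have holC: "C holomorphic_on \<Omega>"
    unfolding C_def
  proof (intro holomorphic_intros)
    fix \<gamma> assume "\<gamma> \<in> \<Gamma>"
    then show "(\<lambda>z. contour_integral \<gamma> (\<lambda>u. \<phi> u / (u - z))) holomorphic_on \<Omega>"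
      using sub[of \<gamma>] frontier
      by (intro holomorphic_on_subset[OF Cauchy_transform_holomorphic[OF smooth]]
          continuous_on_subset[OF cont\<phi>]) auto
  qed
  have limD: "(D \<longlongrightarrow> Q x) (at x within X - frontier \<Omega>)" if x: "x \<in> frontier \<Omega>" for x
  proof -
    have xX: "x \<in> X" using x frontier X by auto
    have "\<forall>\<gamma>\<in>\<Gamma>. \<exists>l. ((\<lambda>z. contour_integral \<gamma> (\<lambda>u. \<phi> u / (u - z)) - 2 * of_real pi * \<i> * \<phi> z * winding_number \<gamma> z)
           \<longlongrightarrow> l) (at x within X - frontier \<Omega>)"
    proof
      fix \<gamma> assume \<gamma>: "\<gamma> \<in> \<Gamma>"
      have "X - frontier \<Omega> \<subseteq> X - path_image \<gamma>" using sub(1)[OF \<gamma>] by blast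
      then show "\<exists>l. ((\<lambda>z. contour_integral \<gamma> (\<lambda>u. \<phi> u / (u - z)) - 2 * of_real pi * \<i> * \<phi> z * winding_number \<gamma> z)
           \<longlongrightarrow> l) (at x within X - frontier \<Omega>)"
        using Cauchy_transform_limit[OF smooth[OF \<gamma>] lip sub(2)[OF \<gamma>] xX] tendsto_within_subset by blast
    qed
    from bchoice[OF this] obtain l where l: "\<forall>\<gamma>\<in>\<Gamma>.
        ((\<lambda>z. contour_integral \<gamma> (\<lambda>u. \<phi> u / (u - z)) - 2 * of_real pi * \<i> * \<phi> z * winding_number \<gamma> z)
           \<longlongrightarrow> l \<gamma>) (at x within X - frontier \<Omega>)" ..
    have lim: "(D \<longlongrightarrow> (\<Sum>\<gamma>\<in>\<Gamma>. l \<gamma>)) (at x within X - frontier \<Omega>)"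
      using tendsto_sum[OF l[rule_format]] by (simp add: D_def C_def N_def sum_subtractf sum_distrib_left)
    \<comment> \<open>Since the limit of \<open>D\<close> is known to exist, a single path of
      approach identifies it; the outer normal is such a path.\<close>
    obtain v where v: "v \<noteq> 0" "\<forall>\<^sub>F \<epsilon> in at_right 0. x + of_real \<epsilon> * v \<notin> closure \<Omega> \<and> N (x + of_real \<epsilon> * v) = 0"
      using boundary_winding(2)[OF \<Omega> pos x] by (auto simp: N_def)
    have limv: "((\<lambda>\<epsilon>. x + of_real \<epsilon> * v) \<longlongrightarrow> x) (at_right 0)"
    proof -
      have "((\<lambda>\<epsilon>. x + of_real \<epsilon> * v) \<longlongrightarrow> x + of_real 0 * v) (at_right 0)" by (intro tendsto_intros)
      then show ?thesis by simp
    qed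
    have "\<forall>\<^sub>F \<epsilon> in at_right 0. x + of_real \<epsilon> * v \<in> X" using topological_tendstoD[OF limv X(1) xX] .
    moreover have "\<forall>\<^sub>F \<epsilon>::real in at_right 0. \<epsilon> > 0" by (rule eventually_at_right_less)
    ultimately have "\<forall>\<^sub>F \<epsilon> in at_right 0. x + of_real \<epsilon> * v \<in> X - frontier \<Omega> \<and> x + of_real \<epsilon> * v \<noteq> x"
      using v(2) by eventually_elim (use v(1) frontier in auto)
    then have "filterlim (\<lambda>\<epsilon>. x + of_real \<epsilon> * v) (at x within X - frontier \<Omega>) (at_right 0)"
      using limv unfolding filterlim_at by blast
    from filterlim_compose[OF lim this]
    have 1: "((\<lambda>\<epsilon>. D (x + of_real \<epsilon> * v)) \<longlongrightarrow> (\<Sum>\<gamma>\<in>\<Gamma>. l \<gamma>)) (at_right 0)" .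
    have "((\<lambda>\<epsilon>. Q (x + of_real \<epsilon> * v)) \<longlongrightarrow> Q x) (at_right 0)"
      using isCont_tendsto_compose[OF contQ[OF x] limv] .
    moreover have "\<forall>\<^sub>F \<epsilon> in at_right 0. Q (x + of_real \<epsilon> * v) = D (x + of_real \<epsilon> * v)"
      using v(2) by eventually_elim (simp add: D_def C_def outside)
    ultimately have "((\<lambda>\<epsilon>. D (x + of_real \<epsilon> * v)) \<longlongrightarrow> Q x) (at_right 0)"
      by (rule Lim_transform_eventually)
    with 1 have "(\<Sum>\<gamma>\<in>\<Gamma>. l \<gamma>) = Q x" using tendsto_unique trivial_limit_at_right_real by blast
    with lim show ?thesis by simp
  qed
  \<comment> \<open>The expected boundary values are built into the definition; what has to be shown
    is that they fit continuously to the values inside.\<close>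
  define H where "H = (\<lambda>z. if z \<in> \<Omega> then C z / (2 * of_real pi * \<i>) else \<phi> z + Q z / (2 * of_real pi * \<i>))"
  have holH: "H holomorphic_on \<Omega>"
  proof -
    have "(\<lambda>z. C z / (2 * of_real pi * \<i>)) holomorphic_on \<Omega>"
      by (intro holomorphic_intros holC) auto
    then show ?thesis by (rule holomorphic_transform) (simp add: H_def)
  qed
  moreover have "continuous_on (closure \<Omega>) H"
    unfolding continuous_on_def
  proof
    fix x assume x: "x \<in> closure \<Omega>"
    show "(H \<longlongrightarrow> H x) (at x within closure \<Omega>)"
    proof (cases "x \<in> \<Omega>")
      case True
      then have "isCont H x"
        using holomorphic_on_imp_continuous_on[OF holH] \<Omega>(1) by (simp add: continuous_on_eq_continuous_at)
      then show ?thesis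
        using isCont_def tendsto_within_subset by blast
    next
      case False
      then have xf: "x \<in> frontier \<Omega>" using x frontier by simp
      have c\<phi>: "(\<phi> \<longlongrightarrow> \<phi> x) (at x)"
        using cont\<phi> X x by (metis continuous_on_eq_continuous_at isCont_def subsetD)
      \<comment> \<open>Continuity at a boundary point is checked separately for approach from
        \<open>\<Omega>\<close>, where the jump relation enters, and along the frontier, where the
        explicit formula is continuous.\<close>
      have "at x within closure \<Omega> = sup (at x within \<Omega>) (at x within frontier \<Omega>)"
        using frontier closure_subset by (subst at_within_union[symmetric]) (auto intro!: arg_cong2[where f = at_within])
      moreover have "(H \<longlongrightarrow> H x) (at x within \<Omega>)"
      proof -
        have "(D \<longlongrightarrow> Q x) (at x within \<Omega>)"
          using limD[OF xf] by (rule tendsto_within_subset) (use X closure_subset frontier in auto)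
        moreover have "(\<phi> \<longlongrightarrow> \<phi> x) (at x within \<Omega>)" using c\<phi> tendsto_within_subset by blast
        ultimately have "((\<lambda>z. \<phi> z + D z / (2 * of_real pi * \<i>)) \<longlongrightarrow> \<phi> x + Q x / (2 * of_real pi * \<i>)) (at x within \<Omega>)"
          by (intro tendsto_intros) auto
        moreover have "\<phi> z + D z / (2 * of_real pi * \<i>) = H z" if "z \<in> \<Omega>" for z
          using boundary_winding(1)[OF \<Omega> pos that] that
          by (simp add: H_def D_def N_def diff_divide_distrib)
        ultimately show ?thesis
          using False by (auto simp: H_def eventually_at_filter elim!: Lim_transform_eventually)
      qed
      moreover have "(H \<longlongrightarrow> H x) (at x within frontier \<Omega>)"
      proof -
        have "(\<phi> \<longlongrightarrow> \<phi> x) (at x within frontier \<Omega>)" using c\<phi> tendsto_within_subset by blast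
        moreover have "(Q \<longlongrightarrow> Q x) (at x within frontier \<Omega>)"
          using contQ[OF xf] unfolding isCont_def using tendsto_within_subset by blast
        ultimately have "((\<lambda>z. \<phi> z + Q z / (2 * of_real pi * \<i>)) \<longlongrightarrow> \<phi> x + Q x / (2 * of_real pi * \<i>)) (at x within frontier \<Omega>)"
          by (intro tendsto_intros) auto
        moreover have "\<phi> z + Q z / (2 * of_real pi * \<i>) = H z" if "z \<in> frontier \<Omega>" for z
          using that frontier by (simp add: H_def)
        ultimately show ?thesis
          using False by (auto simp: H_def eventually_at_filter elim!: Lim_transform_eventually)
      qed
      ultimately show ?thesis by (simp add: filterlim_sup)
    qed
  qed
  moreover have "H x = \<phi> x + Q x / (2 * of_real pi * \<i>)" if "x \<in> frontier \<Omega>" for x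
    using that frontier by (simp add: H_def)
  ultimately show ?thesis using that by blast
qed

subsection \<open>The boundary of a one-point quadrature domain\<close>

text \<open>The region outside a disc is not convex, so a bound on the derivative gives no Lipschitz
  constant directly. Instead the difference of two products is split by the product rule, with
  \<open>1 / d\<close> bounding each reciprocal and \<open>(1 / d)^2\<close> as Lipschitz constant
  of \<open>1 / cnj z\<close>.\<close>

lemma lipschitz_inverse_cnj_power:
  assumes d: "d > 0"
  shows "\<exists>L. L-lipschitz_on {z. d < norm z} (\<lambda>z. 1 / cnj z ^ p)"
proof (induction p)
  case 0
  show ?case by (auto intro: exI[of _ 0] lipschitz_on_constant)
next
  case (Suc p)
  then obtain L where L: "L-lipschitz_on {z. d < norm z} (\<lambda>z. 1 / cnj z ^ p)" by blast
  have L0: "L \<ge> 0" using L by (rule lipschitz_on_nonneg)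
  have "(1 / d * L + (1 / d) ^ p * (1 / d)\<^sup>2)-lipschitz_on {z. d < norm z} (\<lambda>z. 1 / cnj z ^ Suc p)"
  proof (rule lipschitz_onI)
    fix x y :: complex assume "x \<in> {z. d < norm z}" "y \<in> {z. d < norm z}"
    then have xy: "d < norm x" "d < norm y" by auto
    then have nz: "x \<noteq> 0" "y \<noteq> 0" using d by auto
    have inv: "1 / norm x \<le> 1 / d" "1 / norm y \<le> 1 / d" using xy d by (auto intro!: divide_left_mono mult_pos_pos)
    have "1 / cnj x - 1 / cnj y = (1 / cnj x) * (1 / cnj y) * cnj (y - x)"
      using nz by (simp add: field_simps)
    then have "norm (1 / cnj x - 1 / cnj y) = (1 / norm x) * (1 / norm y) * norm (x - y)"
      by (simp add: norm_mult norm_divide norm_minus_commute del: complex_cnj_diff)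
    also have "\<dots> \<le> (1 / d) * (1 / d) * norm (x - y)"
      using inv d by (intro mult_mono) auto
    finally have 1: "norm (1 / cnj x - 1 / cnj y) \<le> (1 / d)\<^sup>2 * norm (x - y)" by (simp add: power2_eq_square)
    have 2: "norm (1 / cnj x ^ p - 1 / cnj y ^ p) \<le> L * norm (x - y)"
      using lipschitz_on_normD[OF L, of x y] xy by simp
    have 3: "norm (1 / cnj y ^ p) \<le> (1 / d) ^ p"
      using power_mono[OF inv(2), of p] by (simp add: norm_divide norm_power power_divide)
    have "1 / cnj x ^ Suc p - 1 / cnj y ^ Suc p =
        1 / cnj x * (1 / cnj x ^ p - 1 / cnj y ^ p) + 1 / cnj y ^ p * (1 / cnj x - 1 / cnj y)"
      using nz by (simp add: field_simps)
    then have "norm (1 / cnj x ^ Suc p - 1 / cnj y ^ Suc p) \<le>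
        1 / norm x * norm (1 / cnj x ^ p - 1 / cnj y ^ p) + norm (1 / cnj y ^ p) * norm (1 / cnj x - 1 / cnj y)"
      by (metis complex_mod_cnj norm_divide norm_mult norm_one norm_triangle_ineq)
    also have "\<dots> \<le> 1 / d * (L * norm (x - y)) + (1 / d) ^ p * ((1 / d)\<^sup>2 * norm (x - y))"
      using 1 2 3 inv d by (intro add_mono mult_mono) auto
    finally show "dist (1 / cnj x ^ Suc p) (1 / cnj y ^ Suc p) \<le> (1 / d * L + (1 / d) ^ p * (1 / d)\<^sup>2) * dist x y"
      by (simp add: dist_norm algebra_simps)
  qed (use L0 d in auto)
  then show ?case by blast
qed

lemma holomorphic_imp_A_infinity:
  assumes "f holomorphic_on U" "open U" "closure \<Omega> \<subseteq> U"
  shows "f \<in> A_infinity \<Omega>"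
proof -
  have "(deriv ^^ n) f holomorphic_on U" for n using assms by (intro holomorphic_higher_deriv)
  then have "continuous_on (closure \<Omega>) ((deriv ^^ n) f)" for n
    using assms(3) by (meson continuous_on_subset holomorphic_on_imp_continuous_on)
  moreover have "f holomorphic_on \<Omega>"
    using assms closure_subset[of \<Omega>] by (meson holomorphic_on_subset order_trans)
  moreover have "continuous_on (closure \<Omega>) f"
    using assms by (meson holomorphic_on_imp_continuous_on continuous_on_subset)
  ultimately show ?thesis unfolding A_infinity_def by blast
qed

lemma quadrature_Cauchy_transform:
  assumes quad: "one_point_quadrature_domain p \<Omega>" and dom: "smooth_bounded_domain \<Omega>" and "0 \<notin> closure \<Omega>"
  obtains \<Gamma> z0 c where "positive_boundary_param \<Omega> \<Gamma>" "z0 \<in> \<Omega>"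
    "\<forall>z. z \<notin> closure \<Omega> \<longrightarrow>
       (\<Sum>\<gamma>\<in>\<Gamma>. contour_integral \<gamma> (\<lambda>u. (1 / cnj u ^ p) / (u - z))) = c * (z0 ^ p / (z0 - z))"
proof -
  \<comment> \<open>The same choice as in \<open>boundary_integral\<close>, so that the quadrature
    identity unfolds to a sum over this very family.\<close>
  define \<Gamma> where "\<Gamma> = (SOME \<Gamma>. positive_boundary_param \<Omega> \<Gamma>)"
  have \<Gamma>: "positive_boundary_param \<Omega> \<Gamma>"
    using dom someI_ex[of "positive_boundary_param \<Omega>"] by (auto simp: smooth_bounded_domain_def \<Gamma>_def)
  obtain c z0 where c: "z0 \<in> \<Omega>" "\<And>f. f \<in> A_infinity \<Omega> \<Longrightarrow>
        boundary_integral \<Omega> (\<lambda>z. f z * of_real (cmod z powi (- (2 * int p)))) = c * f z0"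
    using quad by (auto simp: one_point_quadrature_domain_def)
  have "(\<Sum>\<gamma>\<in>\<Gamma>. contour_integral \<gamma> (\<lambda>u. (1 / cnj u ^ p) / (u - z))) = c * (z0 ^ p / (z0 - z))"
    if z: "z \<notin> closure \<Omega>" for z
  proof -
    have "(\<lambda>u. u ^ p / (u - z)) \<in> A_infinity \<Omega>"
      by (rule holomorphic_imp_A_infinity[where U = "- {z}"]) (use z in \<open>auto intro!: holomorphic_intros\<close>)
    from c(2)[OF this] have "(\<Sum>\<gamma>\<in>\<Gamma>. contour_integral \<gamma>
        (\<lambda>u. u ^ p / (u - z) * of_real (cmod u powi (- (2 * int p))))) = c * (z0 ^ p / (z0 - z))"
      by (simp add: boundary_integral_def \<Gamma>_def)
    \<comment> \<open>The weight is \<open>1 / (u * cnj u) ^ p\<close>, and \<open>u ^ p\<close>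
      cancels its holomorphic half. The cancellation requires \<open>u \<noteq> 0\<close>, so the
      integrands are compared only on the curve.\<close>
    moreover have "contour_integral \<gamma> (\<lambda>u. u ^ p / (u - z) * of_real (cmod u powi (- (2 * int p)))) =
        contour_integral \<gamma> (\<lambda>u. (1 / cnj u ^ p) / (u - z))" if "\<gamma> \<in> \<Gamma>" for \<gamma>
    proof (rule contour_integral_cong)
      fix u assume "u \<in> path_image \<gamma>"
      then have "u \<in> closure \<Omega>"
        using \<Gamma> that unfolding positive_boundary_param_def frontier_def by blast
      then have u: "u \<noteq> 0" using assms(3) by auto
      have "cmod u powi (- (2 * int p)) = cmod u powi (- int (2 * p))" by simp
      also have "\<dots> = 1 / ((cmod u)\<^sup>2) ^ p"
        by (simp only: power_int_minus power_int_of_nat power_mult inverse_eq_divide)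
      finally have "cmod u powi (- (2 * int p)) = 1 / ((cmod u)\<^sup>2) ^ p" .
      then have "complex_of_real (cmod u powi (- (2 * int p))) = 1 / (u * cnj u) ^ p"
        by (simp only: of_real_divide of_real_power of_real_1 flip: complex_norm_square)
      then show "u ^ p / (u - z) * of_real (cmod u powi (- (2 * int p))) = (1 / cnj u ^ p) / (u - z)"
        using u by (simp add: power_mult_distrib)
    qed simp
    ultimately show ?thesis by simp
  qed
  with \<Gamma> c(1) show ?thesis using that by blast
qed

text \<open>For purely imaginary \<open>c\<close> the real part of \<open>c * G\<close> vanishes on
  the frontier, hence is at most 0 inside by the maximum principle. The choices \<open>\<i>\<close>
  and \<open>- \<i>\<close> make \<open>G\<close> real in \<open>\<Omega>\<close>, and an open
  mapping cannot take only real values.\<close>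

lemma holomorphic_real_on_frontier_constant:
  assumes \<Omega>: "open \<Omega>" "connected \<Omega>" "bounded \<Omega>"
    and G: "G holomorphic_on \<Omega>" "continuous_on (closure \<Omega>) G"
    and real: "\<And>x. x \<in> frontier \<Omega> \<Longrightarrow> Im (G x) = 0"
  obtains k where "\<And>z. z \<in> closure \<Omega> \<Longrightarrow> G z = k"
proof -
  have Im0: "Im (G z) = 0" if "z \<in> \<Omega>" for z
  proof -
    have "Re (c * G z) \<le> 0" if c: "Re c = 0" for c
    proof (rule maximum_real_frontier[where f = "\<lambda>z. c * G z" and S = \<Omega>])
      show "(\<lambda>z. c * G z) holomorphic_on interior \<Omega>"
        using G \<Omega> by (simp add: interior_open holomorphic_on_mult holomorphic_on_const)
      show "continuous_on (closure \<Omega>) (\<lambda>z. c * G z)"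
        using G by (intro continuous_intros)
      show "Re (c * G x) \<le> 0" if "x \<in> frontier \<Omega>" for x
        using real[OF that] c by simp
    qed (use \<Omega> \<open>z \<in> \<Omega>\<close> in auto)
    from this[of \<i>] this[of "- \<i>"]
    show ?thesis by simp
  qed
  have "G constant_on \<Omega>"
  proof (rule ccontr)
    assume nc: "\<not> G constant_on \<Omega>"
    then have "open (G ` \<Omega>)" using open_mapping_thm[OF G(1) \<Omega>(1,2,1)] by simp
    moreover obtain z where z: "z \<in> \<Omega>" using nc by (auto simp: constant_on_def)
    ultimately obtain e where e: "e > 0" "cball (G z) e \<subseteq> G ` \<Omega>" by (meson image_eqI open_contains_cball)
    then have "G z + \<i> * of_real e \<in> cball (G z) e" by (simp add: dist_norm norm_mult)
    with e have "G z + \<i> * of_real e \<in> G ` \<Omega>" by blast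
    then obtain w where "w \<in> \<Omega>" "G w = G z + \<i> * of_real e" by auto
    then show False using Im0[of w] Im0[OF z] e(1) by simp
  qed
  then have "G constant_on closure \<Omega>" using constant_on_closureI[OF _ G(2)] by blast
  then show ?thesis using that by (auto simp: constant_on_def)
qed

lemma quadrature_boundary_circle:
  assumes dom: "smooth_bounded_domain \<Omega>" and quad: "one_point_quadrature_domain p \<Omega>" and 0: "0 \<notin> closure \<Omega>"
  obtains z0 R where "z0 \<in> \<Omega>" "\<forall>x\<in>frontier \<Omega>. norm (1 / x ^ p - 1 / z0 ^ p) = R"
proof -
  obtain \<Gamma> z0 c where \<Gamma>: "positive_boundary_param \<Omega> \<Gamma>" and z0: "z0 \<in> \<Omega>" and
    C: "\<forall>z. z \<notin> closure \<Omega> \<longrightarrow>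
       (\<Sum>\<gamma>\<in>\<Gamma>. contour_integral \<gamma> (\<lambda>u. (1 / cnj u ^ p) / (u - z))) = c * (z0 ^ p / (z0 - z))"
    by (rule quadrature_Cauchy_transform[OF quad dom 0]) (rule that)
  have \<Omega>: "open \<Omega>" "connected \<Omega>" "bounded \<Omega>" "\<Omega> \<noteq> {}"
    using dom z0 by (auto simp: smooth_bounded_domain_def)
  have frontier: "frontier \<Omega> = closure \<Omega> - \<Omega>" using \<Omega> by (simp add: frontier_def interior_open)
  \<comment> \<open>The strict inequality provides an open neighbourhood of the closure on which
    \<open>1 / cnj z ^ p\<close> is Lipschitz.\<close>
  obtain d where d: "d > 0" "closure \<Omega> \<subseteq> {z. d < norm z}"
  proof -
    have "open (- closure \<Omega>)" "0 \<in> - closure \<Omega>" using 0 by auto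
    then obtain d where "d > 0" "cball 0 d \<subseteq> - closure \<Omega>" by (meson open_contains_cball)
    then show ?thesis using that[of d] by (force simp: subset_iff not_le)
  qed
  obtain L where L: "L-lipschitz_on {z. d < norm z} (\<lambda>z. 1 / cnj z ^ p)"
    using lipschitz_inverse_cnj_power[OF d(1)] by blast
  have op: "open {z::complex. d < norm z}" by (intro open_Collect_less continuous_intros)
  have ic: "isCont (\<lambda>z. c * (z0 ^ p / (z0 - z))) x" if "x \<in> frontier \<Omega>" for x
    using that z0 frontier by (intro continuous_intros) auto
  obtain H where H: "H holomorphic_on \<Omega>" "continuous_on (closure \<Omega>) H"
    "\<And>x. x \<in> frontier \<Omega> \<Longrightarrow> H x = 1 / cnj x ^ p + c * (z0 ^ p / (z0 - x)) / (2 * of_real pi * \<i>)"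
    using Cauchy_transform_boundary_values[OF \<Omega> \<Gamma> L op d(2) C[rule_format] ic] by metis
  define w where "w = (\<lambda>z::complex. 1 / z ^ p)"
  have holw: "w holomorphic_on - {0}" unfolding w_def by (intro holomorphic_intros) auto
  \<comment> \<open>The difference quotient of \<open>w\<close> at \<open>z0\<close> with its
    removable singularity filled in.\<close>
  define q where "q = (\<lambda>z. if z = z0 then deriv w z0 else (w z - w z0) / (z - z0))"
  have holq: "q holomorphic_on - {0}" unfolding q_def by (intro pole_lemma_open holw) auto
  define A where "A = c * z0 ^ p / (2 * of_real pi * \<i>)"
  \<comment> \<open>With \<open>S z = H z + A / (z - z0)\<close>, which agrees with
    \<open>cnj (w z)\<close> on the frontier, this is
    \<open>(S z - cnj (w z0)) * (w z - w z0)\<close>: the zero of the second factor cancels the pole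
    of the first, and \<open>A * q z\<close> is the product of these two parts.\<close>
  define G where "G = (\<lambda>z. (H z - cnj (w z0)) * (w z - w z0) + A * q z)"
  have sub: "closure \<Omega> \<subseteq> - {0}" "\<Omega> \<subseteq> - {0}" using 0 closure_subset by auto
  have Gfr: "G x = of_real ((norm (w x - w z0))\<^sup>2)" if x: "x \<in> frontier \<Omega>" for x
  proof -
    have ne: "x \<noteq> z0" using x z0 frontier by auto
    have "c * (z0 ^ p / (z0 - x)) / (2 * of_real pi * \<i>) = A / (z0 - x)"
      by (simp add: A_def)
    then have Hx: "H x = cnj (w x) + A / (z0 - x)" using H(3)[OF x] by (simp add: w_def)
    have "A / (z0 - x) * (w x - w z0) + A * q x = 0"
      using ne by (simp add: q_def field_simps)
    then have "G x = cnj (w x - w z0) * (w x - w z0)"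
      unfolding G_def Hx by (simp add: algebra_simps)
    then show ?thesis by (simp only: complex_norm_square mult.commute)
  qed
  have "G holomorphic_on \<Omega>"
    unfolding G_def using H(1) sub holw holq by (intro holomorphic_intros) (auto intro: holomorphic_on_subset)
  moreover have "continuous_on (closure \<Omega>) G"
    unfolding G_def using H(2) sub holw holq
    by (intro continuous_intros) (auto intro: holomorphic_on_imp_continuous_on continuous_on_subset)
  ultimately obtain k where k: "\<And>z. z \<in> closure \<Omega> \<Longrightarrow> G z = k"
    using holomorphic_real_on_frontier_constant[OF \<Omega>(1-3)] Gfr by (metis Im_complex_of_real)
  have "norm (w x - w z0) = sqrt (norm k)" if "x \<in> frontier \<Omega>" for x
    using Gfr[OF that] k[of x] that frontier by (metis DiffD1 abs_norm_cancel norm_of_real norm_power real_sqrt_abs real_sqrt_power power2_abs abs_power2)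
  then show ?thesis using that[OF z0, of "sqrt (norm k)"] by (simp add: w_def)
qed

subsection \<open>Recovering the domain from its image\<close>

text \<open>Inversion maps a disc whose closure misses 0 onto a disc. The assumption
  \<open>R < norm w0\<close> makes \<open>D\<close> positive, so that the quadratic inequality in
  \<open>u\<close> obtained by clearing denominators describes the inside of a circle and not its
  outside.\<close>

lemma image_reciprocal_ball:
  fixes w0 :: complex and R :: real
  assumes R: "R < norm w0" and u: "u \<noteq> 0"
  defines "D \<equiv> (norm w0)\<^sup>2 - R\<^sup>2"
  assumes R0: "R > 0"
  shows "norm (1 / u - w0) < R \<longleftrightarrow> u \<in> ball (cnj w0 / of_real D) (R / D)"
proof -
  have D: "D > 0" using R R0 by (simp add: D_def power_strict_mono)
  define m where "m = Re (w0 * u)"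
  have 1: "(norm (1 - w0 * u))\<^sup>2 = 1 - 2 * m + (norm w0)\<^sup>2 * (norm u)\<^sup>2"
    unfolding cmod_power2 m_def by (simp add: power2_eq_square algebra_simps)
  have 2: "(norm (of_real D * u - cnj w0))\<^sup>2 = D\<^sup>2 * (norm u)\<^sup>2 - 2 * D * m + (norm w0)\<^sup>2"
    unfolding cmod_power2 m_def by (simp add: power2_eq_square algebra_simps)
  have "norm (1 / u - w0) = norm ((1 - w0 * u) / u)" using u by (simp add: field_simps)
  also have "\<dots> < R \<longleftrightarrow> norm (1 - w0 * u) < R * norm u"
    using u by (simp add: norm_divide divide_less_eq)
  also have "\<dots> \<longleftrightarrow> (norm (1 - w0 * u))\<^sup>2 < (R * norm u)\<^sup>2"
    using R0 by (simp add: power_mono_iff abs_le_square_iff flip: not_le)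
  also have "\<dots> \<longleftrightarrow> 1 - 2 * m + D * (norm u)\<^sup>2 < 0"
    unfolding 1 by (simp add: D_def power_mult_distrib algebra_simps)
  \<comment> \<open>Multiplication by \<open>D\<close> completes the square: the product equals
    \<open>norm (D * u - cnj w0)^2 - R^2\<close>, because \<open>D\<close> is
    \<open>norm w0 ^ 2 - R^2\<close>.\<close>
  also have "\<dots> \<longleftrightarrow> D * (1 - 2 * m + D * (norm u)\<^sup>2) < 0"
    using D by (simp add: mult_less_0_iff)
  also have "\<dots> \<longleftrightarrow> (norm (of_real D * u - cnj w0))\<^sup>2 < R\<^sup>2"
    unfolding 2 by (simp add: D_def power2_eq_square algebra_simps)
  also have "\<dots> \<longleftrightarrow> norm (of_real D * u - cnj w0) < R"
    using R0 by (simp add: power_mono_iff flip: not_le)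
  also have "of_real D * u - cnj w0 = of_real D * (u - cnj w0 / of_real D)"
    using D by (simp add: field_simps)
  also have "norm \<dots> < R \<longleftrightarrow> norm (u - cnj w0 / of_real D) < R / D"
    using D by (simp only: norm_mult norm_of_real) (simp add: pos_less_divide_eq mult.commute)
  finally show ?thesis by (simp add: dist_norm norm_minus_commute)
qed

text \<open>By the maximum modulus principle and the open mapping theorem the image is an open
  subset of the open disc. The frontier is sent to the circle, so inside the disc the image
  coincides with the compact image of the closure and is relatively closed as well; connectedness of
  the disc gives equality.\<close>

lemma holomorphic_image_eq_ball:
  assumes \<Omega>: "open \<Omega>" "connected \<Omega>" "bounded \<Omega>" "z0 \<in> \<Omega>"
    and w: "w holomorphic_on \<Omega>" "continuous_on (closure \<Omega>) w" "\<not> w constant_on \<Omega>"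
    and fr: "\<And>x. x \<in> frontier \<Omega> \<Longrightarrow> norm (w x - w z0) = R"
  shows "R > 0" "w ` \<Omega> = ball (w z0) R" "w ` closure \<Omega> = cball (w z0) R"
proof -
  have frontier: "frontier \<Omega> = closure \<Omega> - \<Omega>" using \<Omega> by (simp add: frontier_def interior_open)
  have le: "norm (w z - w z0) \<le> R" if "z \<in> \<Omega>" for z
    by (rule maximum_modulus_frontier[where f = "\<lambda>z. w z - w z0" and S = \<Omega>])
       (use w fr \<Omega> that in \<open>auto simp: interior_open intro!: continuous_intros holomorphic_intros\<close>)
  have opn: "open (w ` \<Omega>)" using open_mapping_thm[OF w(1) \<Omega>(1,2,1)] w(3) by simp
  have "w ` \<Omega> \<subseteq> cball (w z0) R" using le by (auto simp: dist_norm norm_minus_commute)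
  then have sub: "w ` \<Omega> \<subseteq> ball (w z0) R"
    using opn interior_maximal interior_cball by metis
  then have "w z0 \<in> ball (w z0) R" using \<Omega>(4) by blast
  then show R: "R > 0" by simp
  have "w ` closure \<Omega> = w ` \<Omega> \<union> w ` frontier \<Omega>"
    using frontier closure_subset by blast
  moreover have "w ` frontier \<Omega> \<inter> ball (w z0) R = {}"
    using fr by (force simp: dist_norm norm_minus_commute)
  ultimately have eq: "w ` \<Omega> = ball (w z0) R \<inter> w ` closure \<Omega>" using sub by blast
  have "compact (w ` closure \<Omega>)" using \<Omega> w(2) by (intro compact_continuous_image) auto
  then have cl: "closed (w ` closure \<Omega>)" by (rule compact_imp_closed)
  have "openin (top_of_set (ball (w z0) R)) (w ` \<Omega>)" using opn sub by (simp add: openin_open_eq)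
  moreover have "closedin (top_of_set (ball (w z0) R)) (w ` \<Omega>)" using cl eq by (auto simp: closedin_closed)
  moreover have "w ` \<Omega> \<noteq> {}" using \<Omega>(4) by blast
  ultimately show im: "w ` \<Omega> = ball (w z0) R"
    using connected_clopen[of "ball (w z0) R"] by (metis convex_connected convex_ball)
  show "w ` closure \<Omega> = cball (w z0) R"
  proof
    have "ball (w z0) R \<subseteq> w ` closure \<Omega>" using im closure_subset by blast
    then show "cball (w z0) R \<subseteq> w ` closure \<Omega>"
      using cl R by (metis closure_ball closure_minimal)
    show "w ` closure \<Omega> \<subseteq> cball (w z0) R"
    proof clarify
      fix z assume "z \<in> closure \<Omega>"
      then show "w z \<in> cball (w z0) R"
        using le[of z] fr[of z] frontier by (cases "z \<in> \<Omega>") (auto simp: dist_norm norm_minus_commute)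
    qed
  qed
qed

text \<open>A disc that misses 0 carries a logarithm. Subtracting its value at \<open>z0 ^ p\<close>
  before dividing by \<open>p\<close>, and multiplying by \<open>z0\<close> afterwards, selects the
  branch that passes through \<open>z0\<close>.\<close>

lemma pth_root_branch_on_ball:
  assumes p: "p \<ge> 1" and "0 \<notin> ball a r" and z0: "z0 ^ p \<in> ball a r"
  obtains g where "g holomorphic_on ball a r" "\<And>z. z \<in> ball a r \<Longrightarrow> g z ^ p = z" "g (z0 ^ p) = z0"
proof -
  have "z0 ^ p \<noteq> 0" using assms(2) z0 by metis
  obtain l where l: "l holomorphic_on ball a r" "\<And>z. z \<in> ball a r \<Longrightarrow> exp (l z) = z"
    by (rule holomorphic_logarithm_exists[of "ball a r" "\<lambda>z. z" "z0 ^ p"])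
       (use assms in \<open>auto intro: holomorphic_intros\<close>)
  define g where "g = (\<lambda>z. z0 * exp ((l z - l (z0 ^ p)) / of_nat p))"
  show ?thesis
  proof (rule that)
    show "g holomorphic_on ball a r" unfolding g_def using p by (intro holomorphic_intros l) auto
    show "g (z0 ^ p) = z0" by (simp add: g_def)
    fix z assume z: "z \<in> ball a r"
    have "g z ^ p = z0 ^ p * exp (l z - l (z0 ^ p))"
      using p by (simp add: g_def power_mult_distrib flip: exp_of_nat_mult)
    also have "\<dots> = z" using l(2)[OF z] l(2)[OF z0] \<open>z0 ^ p \<noteq> 0\<close> by (simp add: exp_diff)
    finally show "g z ^ p = z" .
  qed
qed

lemma eq_branch_image:
  fixes \<Omega> B :: "complex set"
  assumes \<Omega>: "open \<Omega>" "connected \<Omega>" "z0 \<in> \<Omega>"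
    and im: "(\<lambda>z. z ^ p) ` \<Omega> = B" and B: "open B"
    and g: "continuous_on B g" "\<And>b. b \<in> B \<Longrightarrow> g b ^ p = b" "g (z0 ^ p) = z0"
    and op: "open (g ` B)"
  shows "\<Omega> = g ` B"
proof -
  have fix_eq: "{z \<in> \<Omega>. g (z ^ p) = z} = \<Omega> \<inter> g ` B"
  proof (intro set_eqI iffI)
    fix z assume "z \<in> {z \<in> \<Omega>. g (z ^ p) = z}"
    then have "z \<in> \<Omega>" "z = g (z ^ p)" by auto
    then show "z \<in> \<Omega> \<inter> g ` B" using im by blast
  next
    fix z assume "z \<in> \<Omega> \<inter> g ` B"
    then show "z \<in> {z \<in> \<Omega>. g (z ^ p) = z}" using g(2) by auto
  qed
  have cont: "continuous_on \<Omega> (\<lambda>z. g (z ^ p))"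
    by (rule continuous_on_compose2[OF g(1) continuous_on_power[OF continuous_on_id]]) (use im in auto)
  have "openin (top_of_set \<Omega>) {z \<in> \<Omega>. g (z ^ p) = z}"
    unfolding fix_eq using op by (auto simp: openin_open)
  moreover have "closedin (top_of_set \<Omega>) {z \<in> \<Omega>. g (z ^ p) - z = 0}"
    by (intro continuous_closedin_preimage_constant continuous_intros cont)
  moreover have "z0 \<in> {z \<in> \<Omega>. g (z ^ p) = z}" using \<Omega>(3) g(3) by simp
  ultimately have eq: "{z \<in> \<Omega>. g (z ^ p) = z} = \<Omega>"
    using \<Omega>(2) unfolding connected_clopen by auto
  show ?thesis
  proof
    show "\<Omega> \<subseteq> g ` B" using eq fix_eq by blast
    show "g ` B \<subseteq> \<Omega>"
    proof clarify
      fix b assume "b \<in> B"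
      then obtain z where "z \<in> \<Omega>" "b = z ^ p" using im by blast
      moreover from this have "g (z ^ p) = z" using eq by blast
      ultimately show "g b \<in> \<Omega>" by simp
    qed
  qed
qed

theorem corollary4:
  fixes p :: nat and \<Omega> :: "complex set"
  assumes "p \<ge> 1"
    and "smooth_bounded_domain \<Omega>"
    and "one_point_quadrature_domain p \<Omega>"
    and "0 \<notin> closure \<Omega>"
  shows "pth_root_of_disc p \<Omega>"
proof -
  obtain z0 R where z0: "z0 \<in> \<Omega>" and
    circle: "\<forall>x\<in>frontier \<Omega>. norm (1 / x ^ p - 1 / z0 ^ p) = R"
    using quadrature_boundary_circle[OF assms(2,3,4)] by blast
  have \<Omega>: "open \<Omega>" "connected \<Omega>" "bounded \<Omega>"
    using assms(2) by (auto simp: smooth_bounded_domain_def)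
  have nz: "z \<noteq> 0" if "z \<in> closure \<Omega>" for z using that assms(4) by auto
  have nz\<Omega>: "z \<noteq> 0" if "z \<in> \<Omega>" for z using that nz closure_subset by blast
  define w where "w = (\<lambda>z::complex. 1 / z ^ p)"
  have circle_w: "norm (w x - w z0) = R" if "x \<in> frontier \<Omega>" for x
    using circle that by (simp add: w_def)
  have hol: "w holomorphic_on \<Omega>" unfolding w_def using nz\<Omega> by (intro holomorphic_intros) auto
  have cont: "continuous_on (closure \<Omega>) w" unfolding w_def using nz by (intro continuous_intros) auto
  \<comment> \<open>Otherwise the nonempty open set \<open>\<Omega>\<close> would lie in a single
    fibre of the \<open>p\<close>-th power, which is finite.\<close>
  have "\<not> w constant_on \<Omega>"
  proof
    assume "w constant_on \<Omega>"
    then have "w z = w z0" if "z \<in> \<Omega>" for z using z0 that by (auto simp: constant_on_def)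
    then have "\<Omega> \<subseteq> {z. z ^ p = z0 ^ p}" using nz\<Omega> by (auto simp: w_def)
    moreover have "finite {z. z ^ p = z0 ^ p}" using assms(1) by (intro finite_nth_roots) auto
    ultimately have "finite \<Omega>" by (rule finite_subset)
    then show False using \<Omega>(1) z0 finite_imp_not_open by blast
  qed
  note image = holomorphic_image_eq_ball[OF \<Omega> z0 hol cont this circle_w]
  \<comment> \<open>The image of the closure is the closed disc. That this closed disc misses 0
    gives the strict inequality \<open>R < norm (w z0)\<close>, which after division by
    \<open>D\<close> becomes \<open>r < norm a\<close>.\<close>
  have "0 \<notin> w ` closure \<Omega>" using nz by (auto simp: w_def)
  then have R: "R < norm (w z0)" using image(3) by (auto simp: dist_norm not_le)
  define D where "D = (norm (w z0))\<^sup>2 - R\<^sup>2"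
  define a where "a = cnj (w z0) / of_real D"
  define r where "r = R / D"
  have D: "D > 0" using R image(1) by (simp add: D_def power_strict_mono)
  have ar: "0 < r" "r < norm a"
    using R image(1) D by (auto simp: r_def a_def norm_divide divide_strict_right_mono)
  have power_image: "(\<lambda>z. z ^ p) ` \<Omega> = ball a r"
  proof
    show "(\<lambda>z. z ^ p) ` \<Omega> \<subseteq> ball a r"
    proof clarify
      fix z assume z: "z \<in> \<Omega>"
      then have "w z \<in> ball (w z0) R" using image(2) by blast
      then have "norm (1 / z ^ p - w z0) < R"
        by (simp add: w_def dist_norm norm_minus_commute)
      then show "z ^ p \<in> ball a r"
        using image_reciprocal_ball[OF R _ image(1), of "z ^ p"] nz\<Omega>[OF z] by (simp add: a_def r_def D_def)
    qed
    show "ball a r \<subseteq> (\<lambda>z. z ^ p) ` \<Omega>"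
    proof
      fix u assume u: "u \<in> ball a r"
      then have "u \<noteq> 0" using ar by (auto simp: dist_norm)
      then have "norm (1 / u - w z0) < R"
        using image_reciprocal_ball[OF R _ image(1), of u] u by (simp add: a_def r_def D_def)
      then have "1 / u \<in> ball (w z0) R" by (simp add: dist_norm norm_minus_commute)
      then have "1 / u \<in> w ` \<Omega>" using image(2) by blast
      then obtain z where "z \<in> \<Omega>" "1 / u = 1 / z ^ p" by (auto simp: w_def)
      then show "u \<in> (\<lambda>z. z ^ p) ` \<Omega>" using \<open>u \<noteq> 0\<close> by (intro image_eqI[of _ _ z]) (auto simp: field_simps)
    qed
  qed
  have "0 \<notin> ball a r" using ar by (simp add: dist_norm)
  moreover have "z0 ^ p \<in> ball a r" using power_image z0 by blast
  ultimately obtain g where g: "g holomorphic_on ball a r" "\<And>z. z \<in> ball a r \<Longrightarrow> g z ^ p = z" "g (z0 ^ p) = z0"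
    using pth_root_branch_on_ball[OF assms(1)] by metis
  \<comment> \<open>The \<open>p\<close>-th power is a left inverse of \<open>g\<close>; injectivity
    then makes the image of the disc open.\<close>
  have "inj_on g (ball a r)" using g(2) by (metis inj_onI)
  then have "open (g ` ball a r)" using open_mapping_thm3[OF g(1)] by simp
  then have "\<Omega> = g ` ball a r"
    using eq_branch_image[OF \<Omega>(1,2) z0 power_image _ holomorphic_on_imp_continuous_on[OF g(1)] g(2,3)] by simp
  then show ?thesis unfolding pth_root_of_disc_def using ar g by blast
qed

end
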